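(* Let $F:[0,1]\times\mathbb R\times\mathbb R\to\mathbb R$, $(x,y,z)\mapsto F(x,y,z)$, be continuous and globally Lipschitz with respect to $(y,z)$ with Lipschitz constant $k$, i.e. $|F(x,y,z)-F(x,\tilde y,\tilde z)|\le k(|y-\tilde y|+|z-\tilde z|)$ for all $x\in[0,1]$ and $y,\tilde y,z,\tilde z\in\mathbb R$, where $$k<\left(\sup_{x\in[0,1]}\int_0^1\big(|K(x,y)|+|\partial_xK(x,y)|\big)\,dy\right)^{-1}$$ and $$K(x,y)=\mathbf 1_{\{y\le x\}}\frac{2e^{\Sigma(y)}}{\sigma^2(y)}\int_y^xe^{-\Sigma(z)}dz-2\,\frac{\int_0^xe^{-\Sigma(r)}dr}{\int_0^1e^{-\Sigma(r)}dr}\,\frac{e^{\Sigma(y)}}{\sigma^2(y)}\int_y^1e^{-\Sigma(z)}dz .$$ Then for any $A,B\in\mathbb R$ the boundary value problem $$Lu(x)=F(x,u,u'),\qquad u(0)=A,\qquad u(1)=B$$ has a unique solution.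
   Context: Let $\sigma,\beta:\mathbb R\to\mathbb R$ be continuous with $\sigma>0$. $C^0$ denotes the continuous functions on $\mathbb R$ with the topology of uniform convergence on compacts; $C^k$ the $k$-times continuously differentiable functions on $\mathbb R$ with the topology of uniform convergence on compacts of the function and its first $k$ derivatives. Formally $Lg=\frac{\sigma^2}{2}g''+\beta'g'$. A mollifier is a Schwartz function $\Phi$ on $\mathbb R$ with $\int\Phi(x)\,dx=1$; put $\Phi_n(x)=n\Phi(nx)$, $\sigma_n^2=\sigma^2*\Phi_n$, $\beta_n=\beta*\Phi_n$ (these convolutions are understood to be well defined, as absolutely convergent integrals, for every mollifier) and $L_ng=\frac{\sigma_n^2}{2}g''+\beta_n'g'$. Standing assumption: $\Sigma(x)=\lim_{n\to\infty}2\int_0^x\frac{\beta_n'}{\sigma_n^2}(y)\,dy$ exists in $C^0$, independently of the mollifier. For $l\in C^0$, a function $f\in C^1$ is a $C^1$-solution of $Lf=l$ if for every mollifier $\Phi$ there are sequences $(f_n)$ in $C^2$ and $(l_n)$ in $C^0$ with $L_nf_n=l_n$, $f_n\to f$ in $C^1$, $l_n\to l$ in $C^0$. Boundary value problems: let $-\infty<a<b<\infty$, $A,B\in\mathbb R$. For continuous $g:[a,b]\to\mathbb R$, a function $u:[a,b]\to\mathbb R$ is a solution of $Lu=g$, $u(a)=A$, $u(b)=B$ if there are a continuous extension $\tilde g:\mathbb R\to\mathbb R$ of $g$ and $\tilde u\in C^1$ with $\tilde u|_{[a,b]}=u$ such that $\tilde u$ is a $C^1$-solution of $L\tilde u=\tilde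 g$ and $\tilde u(a)=A$, $\tilde u(b)=B$. For continuous $F:[a,b]\times\mathbb R^2\to\mathbb R$, a function $u\in C^1([a,b])$ is a solution of $Lu=F(x,u,u')$, $u(a)=A$, $u(b)=B$ if it is a solution, in the previous sense, of $Lu=\ell$, $u(a)=A$, $u(b)=B$ with $\ell(x)=F(x,u(x),u'(x))$. For each $y$ the function $x\mapsto K(x,y)$ is absolutely continuous; $\partial_xK$ is its (bounded) derivative, defined for $x\ne y$. *)

theory Defs
  imports "HOL-Analysis.Analysis"
begin

definition Ck :: "nat \<Rightarrow> (real \<Rightarrow> real) \<Rightarrow> bool" where
  "Ck k f \<longleftrightarrow> (\<forall>j<k. \<forall>x. (deriv ^^ j) f field_differentiable at x) \<and>
            continuous_on UNIV ((deriv ^^ k) f)"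

definition Ck_tendsto :: "nat \<Rightarrow> (nat \<Rightarrow> real \<Rightarrow> real) \<Rightarrow> (real \<Rightarrow> real) \<Rightarrow> bool" where
  "Ck_tendsto k fs f \<longleftrightarrow>
     (\<forall>j\<le>k. \<forall>C. compact C \<longrightarrow>
        uniform_limit C (\<lambda>n. (deriv ^^ j) (fs n)) ((deriv ^^ j) f) sequentially)"

definition schwartz :: "(real \<Rightarrow> real) \<Rightarrow> bool" where
  "schwartz \<Phi> \<longleftrightarrow> (\<forall>k. Ck k \<Phi>) \<and> (\<forall>m k. bounded (range (\<lambda>x. x ^ m * (deriv ^^ k) \<Phi> x)))"

definition mollifier :: "(real \<Rightarrow> real) \<Rightarrow> bool" where
  "mollifier \<Phi> \<longleftrightarrow> schwartz \<Phi> \<and> (LINT x|lborel. \<Phi> x) = 1"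

definition rescale :: "(real \<Rightarrow> real) \<Rightarrow> nat \<Rightarrow> real \<Rightarrow> real" where
  "rescale \<Phi> n x = real n * \<Phi> (real n * x)"

definition convolution_exists :: "(real \<Rightarrow> real) \<Rightarrow> (real \<Rightarrow> real) \<Rightarrow> bool" where
  "convolution_exists h \<phi> \<longleftrightarrow> (\<forall>x. integrable lborel (\<lambda>y. h (x - y) * \<phi> y))"

definition convolution :: "(real \<Rightarrow> real) \<Rightarrow> (real \<Rightarrow> real) \<Rightarrow> real \<Rightarrow> real" where
  "convolution h \<phi> x = (LINT y|lborel. h (x - y) * \<phi> y)"

definition sigma2_n :: "(real \<Rightarrow> real) \<Rightarrow> (real \<Rightarrow> real) \<Rightarrow> nat \<Rightarrow> real \<Rightarrow> real" where
  "sigma2_n \<sigma> \<Phi> n = convolution (\<lambda>x. (\<sigma> x)\<^sup>2) (rescale \<Phi> n)"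

definition beta_n :: "(real \<Rightarrow> real) \<Rightarrow> (real \<Rightarrow> real) \<Rightarrow> nat \<Rightarrow> real \<Rightarrow> real" where
  "beta_n \<beta> \<Phi> n = convolution \<beta> (rescale \<Phi> n)"

definition L_n :: "(real \<Rightarrow> real) \<Rightarrow> (real \<Rightarrow> real) \<Rightarrow> (real \<Rightarrow> real) \<Rightarrow> nat \<Rightarrow>
    (real \<Rightarrow> real) \<Rightarrow> real \<Rightarrow> real" where
  "L_n \<sigma> \<beta> \<Phi> n g x =
     sigma2_n \<sigma> \<Phi> n x / 2 * deriv (deriv g) x + deriv (beta_n \<beta> \<Phi> n) x * deriv g x"

text \<open>
  A Schwartz function \<open>\<Phi>\<close> may take negative values, so \<open>sigma2_n \<sigma> \<Phi> n\<close> may have zeros for a given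
  \<open>n\<close>; on each compact set it is eventually positive, so the value chosen for a division by zero
  does not affect the limit below. \<open>LBINT\<close> is the oriented integral, as needed for \<open>x < 0\<close>.
\<close>
definition Sigma_n :: "(real \<Rightarrow> real) \<Rightarrow> (real \<Rightarrow> real) \<Rightarrow> (real \<Rightarrow> real) \<Rightarrow> nat \<Rightarrow> real \<Rightarrow> real" where
  "Sigma_n \<sigma> \<beta> \<Phi> n x = 2 * (LBINT y=0..x. deriv (beta_n \<beta> \<Phi> n) y / sigma2_n \<sigma> \<Phi> n y)"

definition is_Sigma :: "(real \<Rightarrow> real) \<Rightarrow> (real \<Rightarrow> real) \<Rightarrow> (real \<Rightarrow> real) \<Rightarrow> bool" where
  "is_Sigma \<sigma> \<beta> S \<longleftrightarrow>
     Ck 0 S \<and> (\<forall>\<Phi>. mollifier \<Phi> \<longrightarrow> Ck_tendsto 0 (Sigma_n \<sigma> \<beta> \<Phi>) S)"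

definition C1_solution :: "(real \<Rightarrow> real) \<Rightarrow> (real \<Rightarrow> real) \<Rightarrow> (real \<Rightarrow> real) \<Rightarrow> (real \<Rightarrow> real) \<Rightarrow> bool" where
  "C1_solution \<sigma> \<beta> l f \<longleftrightarrow>
     Ck 0 l \<and> Ck 1 f \<and>
     (\<forall>\<Phi>. mollifier \<Phi> \<longrightarrow>
        (\<exists>fs ls. (\<forall>n\<ge>1. Ck 2 (fs n) \<and> Ck 0 (ls n) \<and> L_n \<sigma> \<beta> \<Phi> n (fs n) = ls n) \<and>
                 Ck_tendsto 1 fs f \<and> Ck_tendsto 0 ls l))"

text \<open>
  Functions on \<open>[a, b]\<close> are represented by total functions; the following notions depend only on
  their values on \<open>{a..b}\<close>. At the endpoints, \<open>vector_derivative _ (at x within {a..b})\<close> is the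
  one-sided derivative.
\<close>
definition linear_bvp_solution :: "(real \<Rightarrow> real) \<Rightarrow> (real \<Rightarrow> real) \<Rightarrow> real \<Rightarrow> real \<Rightarrow> real \<Rightarrow> real \<Rightarrow>
    (real \<Rightarrow> real) \<Rightarrow> (real \<Rightarrow> real) \<Rightarrow> bool" where
  "linear_bvp_solution \<sigma> \<beta> a b A B g u \<longleftrightarrow>
     (\<exists>g_ext u_ext. Ck 0 g_ext \<and> (\<forall>x\<in>{a..b}. g_ext x = g x) \<and>
              Ck 1 u_ext \<and> (\<forall>x\<in>{a..b}. u_ext x = u x) \<and>
              C1_solution \<sigma> \<beta> g_ext u_ext \<and> u_ext a = A \<and> u_ext b = B)"

definition C1_interval :: "real \<Rightarrow> real \<Rightarrow> (real \<Rightarrow> real) \<Rightarrow> bool" where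
  "C1_interval a b u \<longleftrightarrow>
     (\<forall>x\<in>{a..b}. u differentiable at x within {a..b}) \<and>
     continuous_on {a..b} (\<lambda>x. vector_derivative u (at x within {a..b}))"

definition bvp_solution :: "(real \<Rightarrow> real) \<Rightarrow> (real \<Rightarrow> real) \<Rightarrow> real \<Rightarrow> real \<Rightarrow> real \<Rightarrow> real \<Rightarrow>
    (real \<Rightarrow> real \<Rightarrow> real \<Rightarrow> real) \<Rightarrow> (real \<Rightarrow> real) \<Rightarrow> bool" where
  "bvp_solution \<sigma> \<beta> a b A B F u \<longleftrightarrow>
     C1_interval a b u \<and>
     linear_bvp_solution \<sigma> \<beta> a b A B
       (\<lambda>x. F x (u x) (vector_derivative u (at x within {a..b}))) u"

definition K :: "(real \<Rightarrow> real) \<Rightarrow> (real \<Rightarrow> real) \<Rightarrow> real \<Rightarrow> real \<Rightarrow> real" where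
  "K \<sigma> S x y =
     indicator {..x} y * (2 * exp (S y) / (\<sigma> y)\<^sup>2) * (LBINT z=y..x. exp (- S z))
     - 2 * ((LBINT r=0..x. exp (- S r)) / (LBINT r=0..1. exp (- S r)))
         * (exp (S y) / (\<sigma> y)\<^sup>2) * (LBINT z=y..1. exp (- S z))"

text \<open>
  For \<open>x\<close> in \<open>{0..1}\<close> and \<open>y \<noteq> x\<close> this is the (at \<open>x = 0\<close> and \<open>x = 1\<close>: one-sided) derivative; the
  unspecified value at \<open>y = x\<close> is irrelevant, since \<open>dK\<close> is only integrated over \<open>y\<close> for fixed \<open>x\<close>.
\<close>
definition dK :: "(real \<Rightarrow> real) \<Rightarrow> (real \<Rightarrow> real) \<Rightarrow> real \<Rightarrow> real \<Rightarrow> real" where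
  "dK \<sigma> S x y = vector_derivative (\<lambda>t. K \<sigma> S t y) (at x within {0..1})"

end

theory Submission
  imports Defs "HOL-Computational_Algebra.Polynomial"
begin

text \<open>
  Multiplying \<open>L f = l\<close> by the integrating factor turns it into the divergence form
  \<open>(exp \<Sigma> f')' = 2 exp \<Sigma> l / \<sigma>\<^sup>2\<close>, in which the derivative of \<open>\<beta>\<close> no longer occurs. This equation,
  for a \<open>C\<^sup>1\<close> function \<open>f\<close>, characterises the \<open>C\<^sup>1\<close>-solutions: the mollified equations have the same form
  and pass to the limit, and conversely \<open>f\<^sub>n' = exp (\<Sigma> - \<Sigma>\<^sub>n) f'\<close> defines approximate solutions.
  The regularity of \<open>\<sigma>\<^sub>n\<^sup>2\<close> and \<open>\<beta>\<^sub>n\<close> and the convergence of \<open>\<sigma>\<^sub>n\<^sup>2\<close> rest on the fact that a function whose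
  convolution with every mollifier exists is integrable against some \<open>(1 + \<bar>y\<bar>)\<^sup>-\<^sup>M\<close>.
  The linear boundary value problem is then solved by the Green kernel \<open>K\<close>, and the hypothesis on \<open>k\<close>
  makes \<open>g \<mapsto> F(x, u, u')\<close>, with \<open>u\<close> the solution of \<open>L u = g\<close>, a contraction of \<open>C([0, 1])\<close>.
\<close>

section \<open>Schwartz functions and tempered growth\<close>

text \<open>The generality of the mollifiers shapes the proof. They need not have compact support,
  so the behaviour of \<open>\<sigma>\<close> and \<open>\<beta>\<close> at infinity matters, and
  all that is known about it is the convergence of integrals; a growth bound is extracted by
  building a test function that would violate the hypothesis. They may change sign, so
  \<open>\<sigma>\<^sub>n\<^sup>2\<close> is positive only eventually on each compact set, and
  division by it is legitimate only there. No limit of \<open>\<beta>\<^sub>n'\<close> is available: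
  limits are taken after it has been absorbed into \<open>\<Sigma>\<^sub>n\<close> or has cancelled.
  The kernel comes from variation of constants. Constants and the primitive s of
  \<open>exp (- \<Sigma>)\<close> span the null space of L, and the second term of \<open>K\<close>,
  with the factor s(x) / s(1), corrects the boundary value at 1. The sum of \<open>K\<close> and its
  derivative in absolute value measures the map from g to (u, u') in the norm in which F is
  Lipschitz.\<close>

lemma DERIV_continuous_UNIV:
  fixes f :: "real \<Rightarrow> real"
  assumes "\<And>x. (f has_real_derivative f' x) (at x)"
  shows "continuous_on UNIV f"
  by (rule DERIV_continuous_on[where D = f']) (rule assms)

lemma bounded_rangeE:
  fixes f :: "'a \<Rightarrow> real"
  assumes "bounded (range f)"
  obtains C where "C \<ge> 0" "\<And>x. \<bar>f x\<bar> \<le> C"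
proof -
  obtain C where "\<And>x. \<bar>f x\<bar> \<le> C" using assms by (auto simp: bounded_iff)
  then show ?thesis by (metis abs_ge_zero order_trans that)
qed

lemma one_plus_power_le:
  fixes t :: real
  assumes "t \<ge> 0"
  shows "(1 + t) ^ m \<le> 2 ^ m * (1 + t ^ m)"
proof -
  have "(1 + t) ^ m \<le> (2 * max 1 t) ^ m" using assms by (intro power_mono) auto
  also have "\<dots> = 2 ^ m * (max 1 t) ^ m" by (simp add: power_mult_distrib)
  also have "\<dots> \<le> 2 ^ m * (1 + t ^ m)"
    using assms by (auto simp: max_def)
  finally show ?thesis .
qed

lemma decayI:
  fixes f :: "real \<Rightarrow> real"
  assumes "bounded (range f)" "bounded (range (\<lambda>x. x ^ m * f x))"
  shows "\<exists>C\<ge>0. \<forall>x. \<bar>f x\<bar> \<le> C / (1 + \<bar>x\<bar>) ^ m"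
proof -
  obtain C where C: "C \<ge> 0" "\<And>x. \<bar>f x\<bar> \<le> C" using bounded_rangeE[OF assms(1)] by blast
  obtain D where D: "D \<ge> 0" "\<And>x. \<bar>x ^ m * f x\<bar> \<le> D" using bounded_rangeE[OF assms(2)] by blast
  have "\<bar>f x\<bar> \<le> 2 ^ m * (C + D) / (1 + \<bar>x\<bar>) ^ m" for x
  proof -
    have "(1 + \<bar>x\<bar>) ^ m * \<bar>f x\<bar> \<le> 2 ^ m * (1 + \<bar>x\<bar> ^ m) * \<bar>f x\<bar>"
      by (intro mult_right_mono one_plus_power_le) auto
    also have "\<dots> = 2 ^ m * (\<bar>f x\<bar> + \<bar>x ^ m * f x\<bar>)"
      by (simp add: algebra_simps abs_mult power_abs)
    also have "\<dots> \<le> 2 ^ m * (C + D)" using C D by (intro mult_left_mono add_mono) auto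
    finally show ?thesis by (simp add: field_simps)
  qed
  then show ?thesis using C D by (intro exI[of _ "2 ^ m * (C + D)"]) auto
qed

lemma schwartz_decay:
  assumes "schwartz \<Phi>"
  obtains C where "C \<ge> 0" "\<And>x. \<bar>(deriv ^^ k) \<Phi> x\<bar> \<le> C / (1 + \<bar>x\<bar>) ^ m"
proof -
  have b: "bounded (range (\<lambda>x. x ^ m * (deriv ^^ k) \<Phi> x))" for m
    using assms by (simp add: schwartz_def)
  show ?thesis using decayI[OF b[of 0, simplified] b[of m]] that by blast
qed

lemma schwartz_DERIV:
  assumes "schwartz \<Phi>"
  shows "((deriv ^^ k) \<Phi> has_real_derivative (deriv ^^ Suc k) \<Phi> x) (at x)"
proof -
  have "Ck (Suc k) \<Phi>" using assms by (simp add: schwartz_def)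
  then have "(deriv ^^ k) \<Phi> field_differentiable at x" by (simp add: Ck_def)
  then show ?thesis by (simp add: field_differentiable_derivI)
qed

lemma deriv_funpow_eq:
  fixes D :: "nat \<Rightarrow> real \<Rightarrow> real"
  assumes "\<And>k x. (D k has_real_derivative D (Suc k) x) (at x)"
  shows "(deriv ^^ k) (D 0) = D k"
proof (induction k)
  case (Suc k)
  have "deriv (D k) = D (Suc k)" using assms by (auto intro!: DERIV_imp_deriv)
  with Suc show ?case by simp
qed auto

text \<open>Naming the whole sequence of derivatives in advance avoids computing iterates of
  \<open>deriv\<close>. For the Gaussian series below, differentiation just raises an index.\<close>

lemma schwartzI:
  fixes D :: "nat \<Rightarrow> real \<Rightarrow> real"
  assumes D: "\<And>k x. (D k has_real_derivative D (Suc k) x) (at x)"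
    and b: "\<And>m k. bounded (range (\<lambda>x. x ^ m * D k x))"
  shows "schwartz (D 0)"
proof -
  have "continuous_on UNIV (D k)" for k
    by (rule DERIV_continuous_UNIV[OF D])
  moreover have "D k field_differentiable at x" for k x
    using D by (auto simp: field_differentiable_def)
  ultimately show ?thesis using b unfolding schwartz_def Ck_def deriv_funpow_eq[of D, OF D] by blast
qed

lemma schwartz_cmult:
  assumes "schwartz f"
  shows "schwartz (\<lambda>x. c * f x)"
proof -
  let ?D = "\<lambda>k x. c * (deriv ^^ k) f x"
  have "schwartz (?D 0)"
  proof (rule schwartzI)
    show "(?D k has_real_derivative ?D (Suc k) x) (at x)" for k x
      using schwartz_DERIV[OF assms] by (intro DERIV_cmult)
    fix m k
    have "bounded (range (\<lambda>x. x ^ m * (deriv ^^ k) f x))" using assms by (simp add: schwartz_def)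
    then have "bounded ((*) c ` range (\<lambda>x. x ^ m * (deriv ^^ k) f x))"
      by (rule bounded_linear_image) (rule bounded_linear_mult_right)
    then show "bounded (range (\<lambda>x. x ^ m * ?D k x))"
      by (simp add: image_image mult.left_commute)
  qed
  then show ?thesis by simp
qed

text \<open>The polynomial factors of the derivatives of \<open>exp (- x\<^sup>2)\<close>, Hermite polynomials up to sign.\<close>

fun gauss_poly :: "nat \<Rightarrow> real poly" where
  "gauss_poly 0 = 1"
| "gauss_poly (Suc k) = pderiv (gauss_poly k) - [:0, 2:] * gauss_poly k"

definition gauss :: "nat \<Rightarrow> real \<Rightarrow> real" where
  "gauss k x = poly (gauss_poly k) x * exp (- x\<^sup>2)"

lemma gauss_DERIV: "(gauss k has_real_derivative gauss (Suc k) x) (at x)"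
  unfolding gauss_def
  by (rule derivative_eq_intros refl poly_DERIV | simp add: algebra_simps)+

text \<open>One term of the exponential series gives
  \<open>\<bar>x\<bar> ^ m \<le> fact m * exp \<bar>x\<bar>\<close>, and
  \<open>\<bar>x\<bar> - x\<^sup>2\<close> is bounded above.\<close>

lemma power_exp_square_bound: "\<bar>x ^ m * exp (- x\<^sup>2)\<bar> \<le> fact m * exp 1" for x :: real
proof -
  have "\<bar>x\<bar> ^ m / fact m \<le> exp \<bar>x\<bar>"
  proof -
    have "(\<Sum>n\<in>{m}. \<bar>x\<bar> ^ n /\<^sub>R fact n) \<le> (\<Sum>n. \<bar>x\<bar> ^ n /\<^sub>R fact n)"
      by (rule sum_le_suminf[OF summable_exp_generic]) auto
    then show ?thesis by (simp add: exp_def divide_inverse mult.commute)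
  qed
  then have "\<bar>x\<bar> ^ m * exp (- x\<^sup>2) \<le> fact m * exp \<bar>x\<bar> * exp (- x\<^sup>2)"
    by (simp add: divide_le_eq mult.commute)
  also have "\<dots> = fact m * exp (\<bar>x\<bar> - x\<^sup>2)" by (simp add: exp_diff exp_minus divide_inverse)
  also have "\<dots> \<le> fact m * exp 1"
  proof -
    have "0 \<le> (\<bar>x\<bar> - 1)\<^sup>2 + x\<^sup>2" by simp
    then have "\<bar>x\<bar> - x\<^sup>2 \<le> 1" by (simp add: power2_diff)
    then show ?thesis by simp
  qed
  finally show ?thesis by (simp add: abs_mult power_abs)
qed

lemma gauss_bounded: "bounded (range (\<lambda>x. x ^ m * gauss k x))"
proof -
  \<comment> \<open>The induction is on the polynomial: \<open>pCons a q\<close> stands for a + x q,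
    and the factor x goes into the monomial and raises \<open>m\<close>. This is why
    \<open>m\<close> is generalised.\<close>
  have "bounded (range (\<lambda>x. x ^ m * (poly q x * exp (- x\<^sup>2))))" for q :: "real poly"
  proof (induction q arbitrary: m)
    case (pCons a q)
    obtain C where C: "\<And>x. \<bar>x ^ Suc m * (poly q x * exp (- x\<^sup>2))\<bar> \<le> C"
      using bounded_rangeE[OF pCons.IH] by blast
    have "\<bar>x ^ m * (poly (pCons a q) x * exp (- x\<^sup>2))\<bar> \<le> \<bar>a\<bar> * (fact m * exp 1) + C" for x
    proof -
      have "x ^ m * (poly (pCons a q) x * exp (- x\<^sup>2)) =
        a * (x ^ m * exp (- x\<^sup>2)) + x ^ Suc m * (poly q x * exp (- x\<^sup>2))"
        by (simp add: algebra_simps)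
      also have "\<bar>\<dots>\<bar> \<le> \<bar>a\<bar> * \<bar>x ^ m * exp (- x\<^sup>2)\<bar> + C"
        using C[of x] abs_triangle_ineq[of "a * (x ^ m * exp (- x\<^sup>2))" "x ^ Suc m * (poly q x * exp (- x\<^sup>2))"]
        by (simp add: abs_mult)
      also have "\<dots> \<le> \<bar>a\<bar> * (fact m * exp 1) + C"
        using power_exp_square_bound by (intro add_mono mult_left_mono) auto
      finally show ?thesis .
    qed
    then show ?case by (auto simp: bounded_iff)
  qed auto
  then show ?thesis by (simp add: gauss_def)
qed

text \<open>\<open>k\<close> is the order of differentiation; each derivative brings a factor
  \<open>1 / b n\<close> by the chain rule. The height \<open>1 / b n ^ n\<close> decays faster than
  every fixed power of the width \<open>b n\<close>, which keeps all Schwartz seminorms finite, and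
  is still large enough to detect a mass of \<open>b n ^ n\<close>.\<close>

definition gauss_series :: "(nat \<Rightarrow> real) \<Rightarrow> nat \<Rightarrow> real \<Rightarrow> real" where
  "gauss_series b k x = (\<Sum>n. gauss k (x / b n) / (b n ^ n * b n ^ k))"

context
  fixes b :: "nat \<Rightarrow> real"
  assumes b: "\<And>n. b n \<ge> 2 ^ n"
begin

lemma b_ge_1: "b n \<ge> 1"
  using b[of n] one_le_power[of "2::real" n] by linarith

text \<open>Only a lower bound on \<open>b n\<close> is available. It suffices because for n > m the
  quotient is a negative power of \<open>b n\<close>, hence at most \<open>1 / b n\<close>, hence at
  most \<open>(1 / 2) ^ n\<close>.\<close>

lemma gauss_series_summable_power: "summable (\<lambda>n. b n ^ m / b n ^ n)"
proof (rule summable_comparison_test'[where N = "Suc m"])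
  show "summable (\<lambda>n. (1 / 2 :: real) ^ n)" by (rule summable_geometric) simp
  fix n assume n: "n \<ge> Suc m"
  have "b n ^ m / b n ^ n = 1 / b n ^ (n - m)"
    using n b_ge_1[of n] by (simp add: power_diff)
  also have "\<dots> \<le> 1 / b n"
    using n b_ge_1[of n] self_le_power[of "b n" "n - m"] by (intro divide_left_mono) auto
  also have "\<dots> \<le> (1 / 2) ^ n"
    using b[of n] b_ge_1[of n] by (simp add: power_divide field_simps)
  finally show "norm (b n ^ m / b n ^ n) \<le> (1 / 2) ^ n"
    using b_ge_1[of n] by simp
qed

text \<open>In the variable \<open>x / b n\<close> the monomial yields the factor
  \<open>b n ^ m\<close>, while \<open>1 / b n ^ k \<le> 1\<close> is dropped. The bound is uniform
  in \<open>x\<close> and summable over \<open>n\<close>.\<close>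

lemma gauss_term_bound:
  assumes "\<And>x. \<bar>x ^ m * gauss k x\<bar> \<le> C"
  shows "\<bar>x ^ m * (gauss k (x / b n) / (b n ^ n * b n ^ k))\<bar> \<le> C * (b n ^ m / b n ^ n)"
proof -
  have p: "b n > 0" "b n ^ k \<ge> 1" using b_ge_1[of n] by auto
  have "x ^ m * (gauss k (x / b n) / (b n ^ n * b n ^ k)) =
      ((x / b n) ^ m * gauss k (x / b n)) * (b n ^ m / b n ^ n) / b n ^ k"
    using p by (simp add: power_divide field_simps)
  also have "\<bar>\<dots>\<bar> = \<bar>(x / b n) ^ m * gauss k (x / b n)\<bar> * (b n ^ m / b n ^ n) / b n ^ k"
    using p by (simp add: abs_mult)
  also have "\<dots> \<le> \<bar>(x / b n) ^ m * gauss k (x / b n)\<bar> * (b n ^ m / b n ^ n) / 1"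
    using p by (intro divide_left_mono) auto
  also have "\<dots> = \<bar>(x / b n) ^ m * gauss k (x / b n)\<bar> * (b n ^ m / b n ^ n)" by simp
  also have "\<dots> \<le> C * (b n ^ m / b n ^ n)"
    using assms p by (intro mult_right_mono) auto
  finally show ?thesis .
qed

lemma gauss_series_summable: "summable (\<lambda>n. x ^ m * (gauss k (x / b n) / (b n ^ n * b n ^ k)))"
proof -
  obtain C where C: "\<And>x. \<bar>x ^ m * gauss k x\<bar> \<le> C" using bounded_rangeE[OF gauss_bounded] by blast
  show ?thesis
    by (rule summable_comparison_test'[OF summable_mult[OF gauss_series_summable_power, of C m]])
      (use gauss_term_bound[OF C] in auto)
qed

lemma gauss_series_DERIV: "(gauss_series b k has_real_derivative gauss_series b (Suc k) x) (at x)"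
proof -
  obtain C where C: "\<And>x. \<bar>x ^ 0 * gauss (Suc k) x\<bar> \<le> C" using bounded_rangeE[OF gauss_bounded] by blast
  have "((\<lambda>x. \<Sum>n. gauss k (x / b n) / (b n ^ n * b n ^ k)) has_real_derivative
     (\<Sum>n. gauss (Suc k) (x / b n) / (b n ^ n * b n ^ Suc k))) (at x)"
  proof (rule has_field_derivative_series'(2)[where S = UNIV and ?x0.0 = 0])
    show "((\<lambda>x. gauss k (x / b n) / (b n ^ n * b n ^ k)) has_real_derivative
        gauss (Suc k) (x / b n) / (b n ^ n * b n ^ Suc k)) (at x within UNIV)" for n x
    proof -
      have "((\<lambda>x. gauss k (x / b n)) has_real_derivative gauss (Suc k) (x / b n) * (1 / b n)) (at x)"
        by (rule DERIV_chain'[OF _ gauss_DERIV]) (use b_ge_1[of n] in \<open>auto intro!: derivative_eq_intros\<close>)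
      from DERIV_cdivide[OF this, of "b n ^ n * b n ^ k"] show ?thesis
        by (simp add: mult_ac)
    qed
    show "uniformly_convergent_on UNIV (\<lambda>n x. \<Sum>i<n. gauss (Suc k) (x / b i) / (b i ^ i * b i ^ Suc k))"
      by (rule Weierstrass_m_test'[OF _ summable_mult[OF gauss_series_summable_power, of C 0]])
        (use gauss_term_bound[OF C] in auto)
    show "summable (\<lambda>n. gauss k (0 / b n) / (b n ^ n * b n ^ k))"
      using gauss_series_summable[of 0 0 k] by simp
  qed auto
  then show ?thesis unfolding gauss_series_def .
qed

lemma gauss_series_schwartz: "schwartz (gauss_series b 0)"
proof (rule schwartzI[of "gauss_series b", OF gauss_series_DERIV])
  fix m k
  obtain C where C: "\<And>x. \<bar>x ^ m * gauss k x\<bar> \<le> C" using bounded_rangeE[OF gauss_bounded] by blast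
  have "\<bar>x ^ m * gauss_series b k x\<bar> \<le> (\<Sum>n. C * (b n ^ m / b n ^ n))" for x
  proof -
    have "x ^ m * gauss_series b k x = (\<Sum>n. x ^ m * (gauss k (x / b n) / (b n ^ n * b n ^ k)))"
      unfolding gauss_series_def using gauss_series_summable[of x 0 k] by (subst suminf_mult) auto
    moreover have "norm (\<Sum>n. x ^ m * (gauss k (x / b n) / (b n ^ n * b n ^ k))) \<le> (\<Sum>n. C * (b n ^ m / b n ^ n))"
      by (rule norm_suminf_le[OF _ summable_mult[OF gauss_series_summable_power]])
        (use gauss_term_bound[OF C] in auto)
    ultimately show ?thesis by simp
  qed
  then show "bounded (range (\<lambda>x. x ^ m * gauss_series b k x))" by (auto simp: bounded_iff)
qed

lemma gauss_series_ge_sum: "gauss_series b 0 x \<ge> (\<Sum>n<N. gauss 0 (x / b n) / b n ^ n)"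
proof -
  have "summable (\<lambda>n. gauss 0 (x / b n) / b n ^ n)" using gauss_series_summable[of x 0 0] by simp
  moreover have "gauss 0 (x / b n) / b n ^ n \<ge> 0" for n
    using b_ge_1[of n] by (simp add: gauss_def)
  ultimately show ?thesis unfolding gauss_series_def by (simp add: sum_le_suminf)
qed

lemma gauss_series_pos: "gauss_series b 0 x > 0"
proof -
  have "gauss 0 (x / b 0) > 0" by (simp add: gauss_def)
  with gauss_series_ge_sum[where N = 1 and x = x] show ?thesis by simp
qed

lemma gauss_series_even: "gauss_series b 0 (- x) = gauss_series b 0 x"
  by (simp add: gauss_series_def gauss_def)

end

text \<open>If the growth bound fails, there are scales \<open>b n \<ge> 2\<^sup>n\<close> on which \<open>g\<close> has mass at least \<open>b n ^ n\<close>, and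
  the superposition of the Gaussians of width \<open>b n\<close> and height \<open>1 / b n ^ n\<close> is a Schwartz function
  against which \<open>g\<close> is not integrable.\<close>

lemma gaussian_test_growth:
  fixes g :: "real \<Rightarrow> real"
  assumes [measurable]: "g \<in> borel_measurable borel" and nonneg: "\<And>y. g y \<ge> 0"
    and int: "\<And>\<Psi>. schwartz \<Psi> \<Longrightarrow> (\<And>y. \<Psi> y > 0) \<Longrightarrow> (\<And>y. \<Psi> (- y) = \<Psi> y) \<Longrightarrow> integrable lborel (\<lambda>y. g y * \<Psi> y)"
  shows "\<exists>N. \<forall>j\<ge>N. (\<integral>\<^sup>+y. ennreal (g y * indicator {-(2^j)..2^j} y) \<partial>lborel) \<le> ennreal (2 ^ (j * N))"
proof (rule ccontr)
  define G where "G = (\<lambda>R. \<integral>\<^sup>+y. ennreal (g y * indicator {-R..R} y) \<partial>lborel)"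
  assume "\<not> ?thesis"
  then have "\<forall>N. \<exists>j\<ge>N. \<not> G (2 ^ j) \<le> ennreal (2 ^ (j * N))" unfolding G_def by simp
  then obtain j where j: "\<And>N. j N \<ge> N" "\<And>N. G (2 ^ j N) > ennreal (2 ^ (j N * N))"
    by (metis not_le)
  define b :: "nat \<Rightarrow> real" where "b = (\<lambda>n. 2 ^ j n)"
  have b: "b n \<ge> 2 ^ n" for n using j(1)[of n] by (simp add: b_def)
  have b_pos: "b n > 0" for n by (simp add: b_def)
  have G: "G (b n) \<ge> ennreal (b n ^ n)" for n
    using j(2)[of n] by (simp add: b_def power_mult)
  define \<Psi> where "\<Psi> = gauss_series b 0"
  have [measurable]: "gauss 0 \<in> borel_measurable borel" unfolding gauss_def by simp
  have "integrable lborel (\<lambda>y. g y * \<Psi> y)"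
    unfolding \<Psi>_def by (intro int gauss_series_schwartz gauss_series_pos gauss_series_even b)
  then have "(\<integral>\<^sup>+y. ennreal (g y * \<Psi> y) \<partial>lborel) < \<infinity>"
    by (subst (asm) integrable_iff_bounded)
      (simp add: abs_mult nonneg gauss_series_pos[OF b, folded \<Psi>_def] less_imp_le)
  then obtain I where I: "I \<ge> 0" "(\<integral>\<^sup>+y. ennreal (g y * \<Psi> y) \<partial>lborel) = ennreal I"
    by (cases "\<integral>\<^sup>+y. ennreal (g y * \<Psi> y) \<partial>lborel") auto
  \<comment> \<open>On \<open>{-b n..b n}\<close> the \<open>n\<close>-th Gaussian is at least
    \<open>exp (- 1)\<close>, and its height times the mass \<open>b n ^ n\<close> is 1. Each scale
    thus contributes at least \<open>exp (- 1)\<close> to a finite integral, which is impossible for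
    arbitrarily many scales.\<close>
  have piece: "ennreal (exp (- 1)) \<le> (\<integral>\<^sup>+y. ennreal (g y * (gauss 0 (y / b n) / b n ^ n)) \<partial>lborel)" for n
  proof -
    have "ennreal (exp (- 1)) = ennreal (exp (- 1) / b n ^ n) * ennreal (b n ^ n)"
      using b_pos[of n] by (simp add: ennreal_mult[symmetric])
    also have "\<dots> \<le> ennreal (exp (- 1) / b n ^ n) * G (b n)"
      using G by (intro mult_left_mono) auto
    also have "\<dots> = (\<integral>\<^sup>+y. ennreal (exp (- 1) / b n ^ n) * ennreal (g y * indicator {-b n..b n} y) \<partial>lborel)"
      unfolding G_def by (rule nn_integral_cmult[symmetric]) measurable
    also have "\<dots> \<le> (\<integral>\<^sup>+y. ennreal (g y * (gauss 0 (y / b n) / b n ^ n)) \<partial>lborel)"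
    proof (intro nn_integral_mono)
      fix y
      have "exp (- 1) / b n ^ n * (g y * indicator {-b n..b n} y) \<le> g y * (gauss 0 (y / b n) / b n ^ n)"
      proof (cases "\<bar>y\<bar> \<le> b n")
        case True
        then have "(y / b n)\<^sup>2 \<le> 1" using b_pos[of n] by (simp add: abs_square_le_1)
        then have "exp (- 1) \<le> gauss 0 (y / b n)" by (simp add: gauss_def)
        then have "g y * (exp (- 1) / b n ^ n) \<le> g y * (gauss 0 (y / b n) / b n ^ n)"
          using b_pos[of n] nonneg[of y] by (intro mult_left_mono divide_right_mono) auto
        moreover have "exp (- 1) / b n ^ n * (g y * indicator {-b n..b n} y) = g y * (exp (- 1) / b n ^ n)"
          using True by (auto simp: indicator_def)
        ultimately show ?thesis by presburger
      next
        case False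
        then have "indicator {-b n..b n} y = (0::real)" by (auto simp: indicator_def)
        then show ?thesis using nonneg[of y] b_pos[of n] by (simp add: gauss_def)
      qed
      then show "ennreal (exp (- 1) / b n ^ n) * ennreal (g y * indicator {-b n..b n} y)
          \<le> ennreal (g y * (gauss 0 (y / b n) / b n ^ n))"
        using b_pos[of n] nonneg[of y] by (simp add: ennreal_mult[symmetric] ennreal_leI)
    qed
    finally show ?thesis .
  qed
  have "real M * exp (- 1) \<le> I" for M
  proof -
    have "ennreal (real M * exp (- 1)) = (\<Sum>n<M. ennreal (exp (- 1)))"
      by (simp add: ennreal_mult ennreal_of_nat_eq_real_of_nat)
    also have "\<dots> \<le> (\<Sum>n<M. \<integral>\<^sup>+y. ennreal (g y * (gauss 0 (y / b n) / b n ^ n)) \<partial>lborel)"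
      by (intro sum_mono piece)
    also have "\<dots> = (\<integral>\<^sup>+y. (\<Sum>n<M. ennreal (g y * (gauss 0 (y / b n) / b n ^ n))) \<partial>lborel)"
      by (rule nn_integral_sum[symmetric]) measurable
    also have "\<dots> \<le> (\<integral>\<^sup>+y. ennreal (g y * \<Psi> y) \<partial>lborel)"
    proof (intro nn_integral_mono)
      fix y
      have "(\<Sum>n<M. ennreal (g y * (gauss 0 (y / b n) / b n ^ n))) =
          ennreal (\<Sum>n<M. g y * (gauss 0 (y / b n) / b n ^ n))"
        using nonneg[of y] b_pos by (intro sum_ennreal) (simp add: gauss_def less_imp_le)
      also have "\<dots> \<le> ennreal (g y * \<Psi> y)"
        unfolding sum_distrib_left[symmetric] \<Psi>_def using nonneg[of y] gauss_series_ge_sum[of b, OF b]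
        by (intro ennreal_leI mult_left_mono) auto
      finally show "(\<Sum>n<M. ennreal (g y * (gauss 0 (y / b n) / b n ^ n))) \<le> ennreal (g y * \<Psi> y)" .
    qed
    finally show ?thesis using I by simp
  qed
  moreover obtain M :: nat where "real M > I * exp 1" using reals_Archimedean2 by blast
  then have "real M * exp (- 1) > I * exp 1 * exp (- 1)" by simp
  then have "real M * exp (- 1) > I" by (simp add: mult.assoc flip: exp_add)
  ultimately show False by (meson not_le)
qed

text \<open>At distance of order \<open>2 ^ j\<close> the weight gains one factor
  \<open>2 ^ j\<close> over the growth \<open>2 ^ (j * N)\<close>, and the reciprocals of these
  factors are summable. Nested intervals replace disjoint dyadic shells: at each point a single term
  of the series already majorises the weight.\<close>

lemma integrable_weight:
  fixes g :: "real \<Rightarrow> real"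
  assumes [measurable]: "g \<in> borel_measurable borel" and nonneg: "\<And>y. g y \<ge> 0"
    and growth: "\<And>j. j \<ge> N \<Longrightarrow> (\<integral>\<^sup>+y. ennreal (g y * indicator {-(2^j)..2^j} y) \<partial>lborel) \<le> ennreal (2 ^ (j * N))"
  shows "integrable lborel (\<lambda>y. g y / (1 + \<bar>y\<bar>) ^ Suc N)"
proof -
  define v :: "nat \<Rightarrow> real \<Rightarrow> real" where
    "v = (\<lambda>i y. indicator {-(2^(N+i))..2^(N+i)} y / 2 ^ ((N + i) * Suc N))"
  \<comment> \<open>This is the constant \<open>2 ^ Suc N\<close> of \<open>key\<close> below,
    raised to the power \<open>Suc N\<close>. The size of that constant is dictated by
    \<open>i = 0\<close>, where nothing better than \<open>1 + \<bar>y\<bar> \<ge> 1\<close> is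
    known.\<close>
  define c :: real where "c = 2 ^ (Suc N * Suc N)"
  have weight: "\<exists>i. 1 / (1 + \<bar>y\<bar>) ^ Suc N \<le> c * v i y" for y :: real
  proof -
    define P where "P = (\<lambda>i. \<bar>y\<bar> \<le> 2 ^ (N + i))"
    obtain n where "\<bar>y\<bar> < 2 ^ n" using real_arch_pow[of 2 "\<bar>y\<bar>"] by auto
    moreover have "(2::real) ^ n \<le> 2 ^ (N + n)" by simp
    ultimately have "P n" unfolding P_def by linarith
    define i where "i = (LEAST i. P i)"
    have Pi: "P i" unfolding i_def by (rule LeastI[of P, OF \<open>P n\<close>])
    have v: "v i y = 1 / 2 ^ ((N + i) * Suc N)"
      using Pi by (auto simp: v_def P_def indicator_def)
    have key: "2 ^ (N + i) \<le> 2 ^ Suc N * (1 + \<bar>y\<bar>)"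
    proof (cases i)
      case 0
      have "(2::real) ^ N \<le> 2 ^ Suc N * 1" by simp
      also have "\<dots> \<le> 2 ^ Suc N * (1 + \<bar>y\<bar>)" by (intro mult_left_mono) auto
      finally show ?thesis using 0 by simp
    next
      case (Suc i')
      then have "\<not> P i'" unfolding i_def by (metis lessI not_less_Least)
      then have "2 ^ (N + i) \<le> 2 * (1 + \<bar>y\<bar>)" unfolding P_def Suc by simp
      also have "\<dots> \<le> 2 ^ Suc N * (1 + \<bar>y\<bar>)" by (intro mult_right_mono) auto
      finally show ?thesis .
    qed
    have "(2 ^ (N + i)) ^ Suc N \<le> (2 ^ Suc N * (1 + \<bar>y\<bar>)) ^ Suc N"
      using key by (intro power_mono) auto
    then have "2 ^ ((N + i) * Suc N) \<le> c * (1 + \<bar>y\<bar>) ^ Suc N"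
      unfolding c_def power_mult power_mult_distrib .
    then have "1 / (1 + \<bar>y\<bar>) ^ Suc N \<le> c * v i y"
      unfolding v by (simp add: divide_le_eq le_divide_eq mult.commute del: power_Suc)
    then show ?thesis ..
  qed
  have v_nonneg: "v i y \<ge> 0" for i y by (simp add: v_def)
  have "(\<integral>\<^sup>+y. ennreal (g y / (1 + \<bar>y\<bar>) ^ Suc N) \<partial>lborel) \<le> (\<integral>\<^sup>+y. (\<Sum>i. ennreal (c * (g y * v i y))) \<partial>lborel)"
  proof (intro nn_integral_mono)
    fix y
    obtain i where i: "1 / (1 + \<bar>y\<bar>) ^ Suc N \<le> c * v i y" using weight by blast
    have "g y * (1 / (1 + \<bar>y\<bar>) ^ Suc N) \<le> g y * (c * v i y)"
      by (rule mult_left_mono[OF i nonneg])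
    then have "ennreal (g y / (1 + \<bar>y\<bar>) ^ Suc N) \<le> ennreal (c * (g y * v i y))"
      by (intro ennreal_leI) (simp add: mult_ac)
    also have "\<dots> = (\<Sum>i\<in>{i}. ennreal (c * (g y * v i y)))" by simp
    also have "\<dots> \<le> (\<Sum>i. ennreal (c * (g y * v i y)))" by (rule sum_le_suminf) auto
    finally show "ennreal (g y / (1 + \<bar>y\<bar>) ^ Suc N) \<le> (\<Sum>i. ennreal (c * (g y * v i y)))" .
  qed
  also have "\<dots> = (\<Sum>i. \<integral>\<^sup>+y. ennreal (c * (g y * v i y)) \<partial>lborel)"
    by (rule nn_integral_suminf) (simp add: v_def)
  also have "\<dots> \<le> (\<Sum>i. ennreal (c * (1 / 2) ^ i))"
  proof (intro suminf_le)
    fix i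
    define d where "d = c / 2 ^ ((N + i) * Suc N)"
    have d: "d \<ge> 0" by (simp add: d_def c_def)
    have "(\<integral>\<^sup>+y. ennreal (c * (g y * v i y)) \<partial>lborel) =
      (\<integral>\<^sup>+y. ennreal d * ennreal (g y * indicator {-(2^(N+i))..2^(N+i)} y) \<partial>lborel)"
      using d nonneg by (intro nn_integral_cong) (simp add: ennreal_mult[symmetric] v_def d_def mult_ac)
    also have "\<dots> = ennreal d * (\<integral>\<^sup>+y. ennreal (g y * indicator {-(2^(N+i))..2^(N+i)} y) \<partial>lborel)"
      by (rule nn_integral_cmult) measurable
    also have "\<dots> \<le> ennreal d * ennreal (2 ^ ((N + i) * N))"
      by (intro mult_left_mono growth) auto
    also have "\<dots> = ennreal (c * (1 / 2 ^ (N + i)))"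
      using d by (simp add: ennreal_mult[symmetric] d_def power_add)
    also have "\<dots> \<le> ennreal (c * (1 / 2) ^ i)"
      by (intro ennreal_leI mult_left_mono) (auto simp: c_def power_divide frac_le)
    finally show "(\<integral>\<^sup>+y. ennreal (c * (g y * v i y)) \<partial>lborel) \<le> ennreal (c * (1 / 2) ^ i)" .
  qed auto
  also have "\<dots> = ennreal (\<Sum>i. c * (1 / 2) ^ i)"
    by (rule suminf_ennreal2) (auto simp: c_def)
  also have "\<dots> < \<infinity>" by simp
  finally show ?thesis using nonneg
    by (intro integrableI_bounded) (auto simp: zero_le_divide_iff)
qed

text \<open>For \<open>g = 1\<close> the growth bound reads
  \<open>2 ^ Suc j \<le> 2 ^ (j * N)\<close>. It fails for \<open>N = 1\<close> and holds for
  \<open>N = 2\<close>, whence the exponent 3.\<close>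

lemma integrable_weight_3: "integrable lborel (\<lambda>y::real. 1 / (1 + \<bar>y\<bar>) ^ 3)"
proof -
  have "integrable lborel (\<lambda>y::real. 1 / (1 + \<bar>y\<bar>) ^ Suc 2)"
  proof (rule integrable_weight[where g = "\<lambda>_. 1"])
    fix j :: nat assume j: "j \<ge> 2"
    have "(\<integral>\<^sup>+y. ennreal (1 * indicator {-(2^j)..2^j :: real} y) \<partial>lborel) = emeasure lborel {-(2^j)..2^j :: real}"
      by (simp add: ennreal_indicator)
    also have "\<dots> = ennreal (2 ^ Suc j)" by simp
    also have "\<dots> \<le> ennreal (2 ^ (j * 2))"
      using j by (intro ennreal_leI power_increasing) auto
    finally show "(\<integral>\<^sup>+y. ennreal (1 * indicator {-(2^j)..2^j :: real} y) \<partial>lborel) \<le> ennreal (2 ^ (j * 2))" .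
  qed auto
  then show ?thesis by (simp add: numeral_3_eq_3 numeral_2_eq_2)
qed

lemma schwartz_continuous: "schwartz \<Phi> \<Longrightarrow> continuous_on UNIV ((deriv ^^ k) \<Phi>)"
  by (simp add: schwartz_def Ck_def)

lemma schwartz_borel: "schwartz \<Phi> \<Longrightarrow> (deriv ^^ k) \<Phi> \<in> borel_measurable borel"
  by (intro borel_measurable_continuous_onI schwartz_continuous)

lemma schwartz_integrable:
  assumes "schwartz \<Phi>"
  shows "integrable lborel \<Phi>"
proof -
  obtain C where "\<And>x. \<bar>(deriv ^^ 0) \<Phi> x\<bar> \<le> C / (1 + \<bar>x\<bar>) ^ 3"
    using schwartz_decay[OF assms] by blast
  then have "AE x in lborel. norm (\<Phi> x) \<le> norm (C * (1 / (1 + \<bar>x\<bar>) ^ 3))"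
    by (intro AE_I2) (simp add: order_trans[OF _ divide_right_mono[OF abs_ge_self]])
  then show ?thesis
    using schwartz_borel[OF assms, of 0]
    by (intro Bochner_Integration.integrable_bound[OF integrable_mult_right[OF integrable_weight_3]]) auto
qed

text \<open>The hypotheses speak of mollifiers only. A positive Schwartz function has nonzero
  integral, so it can be normalised and used as a test function.\<close>

lemma mollifier_of_pos:
  assumes "schwartz \<Psi>" "\<And>y. \<Psi> y > 0"
  shows "(LINT y|lborel. \<Psi> y) > 0" "mollifier (\<lambda>x. 1 / (LINT y|lborel. \<Psi> y) * \<Psi> x)"
proof -
  have int: "integrable lborel \<Psi>" by (rule schwartz_integrable[OF assms(1)])
  have "(LINT y|lborel. \<Psi> y) \<noteq> 0"
  proof
    assume "(LINT y|lborel. \<Psi> y) = 0"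
    then have "AE y in lborel. \<Psi> y = 0"
      using integral_nonneg_eq_0_iff_AE[OF int] assms(2) by (simp add: less_imp_le)
    then have "AE y in lborel. y \<in> ({} :: real set)"
      by eventually_elim (use assms(2) less_irrefl in metis)
    then show False
      using AE_iff_null[of lborel "\<lambda>y. y \<in> ({} :: real set)"] by (simp add: null_sets_def)
  qed
  moreover have "(LINT y|lborel. \<Psi> y) \<ge> 0" using assms(2) by (intro Bochner_Integration.integral_nonneg) (simp add: less_imp_le)
  ultimately show "(LINT y|lborel. \<Psi> y) > 0" by simp
  then show "mollifier (\<lambda>x. 1 / (LINT y|lborel. \<Psi> y) * \<Psi> x)"
    unfolding mollifier_def by (intro conjI schwartz_cmult assms) simp
qed

text \<open>Without a mollifier the condition in \<open>C1_solution\<close> would be vacuous, and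
  nothing could be derived from it. The Gaussian series with \<open>b n = 2 ^ n\<close> provides
  one.\<close>

lemma mollifier_exists: "\<exists>\<Phi>. mollifier \<Phi>"
  using mollifier_of_pos(2)[OF gauss_series_schwartz gauss_series_pos] order_refl by blast

lemma integrable_weight_mono:
  fixes h :: "real \<Rightarrow> real"
  assumes "integrable lborel (\<lambda>y. h y / (1 + \<bar>y\<bar>) ^ M)" "M \<le> N" "h \<in> borel_measurable borel"
  shows "integrable lborel (\<lambda>y. h y / (1 + \<bar>y\<bar>) ^ N)"
proof (rule Bochner_Integration.integrable_bound[OF assms(1)])
  show "AE y in lborel. norm (h y / (1 + \<bar>y\<bar>) ^ N) \<le> norm (h y / (1 + \<bar>y\<bar>) ^ M)"
    using assms(2) by (auto intro!: divide_left_mono power_increasing)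
qed (use assms(3) in measurable)

text \<open>At the point 0 the convolution with a normalised positive \<open>\<Psi>\<close> is, up
  to a constant, the integral of \<open>h (- y) * \<Psi> y\<close>. Its absolute convergence is the
  premise of \<open>gaussian_test_growth\<close> for \<open>\<bar>h (- y)\<bar>\<close>; the
  reflection is undone at the end.\<close>

lemma convolution_exists_imp_tempered:
  assumes cont: "continuous_on UNIV h"
    and conv: "\<And>\<Phi>. mollifier \<Phi> \<Longrightarrow> convolution_exists h (rescale \<Phi> 1)"
  shows "\<exists>M. integrable lborel (\<lambda>y. h y / (1 + \<bar>y\<bar>) ^ M)"
proof -
  have h[measurable]: "h \<in> borel_measurable borel" by (rule borel_measurable_continuous_onI[OF cont])
  define g where "g = (\<lambda>y. \<bar>h (- y)\<bar>)"
  have g[measurable]: "g \<in> borel_measurable borel" unfolding g_def by measurable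
  have "\<exists>N. \<forall>j\<ge>N. (\<integral>\<^sup>+y. ennreal (g y * indicator {-(2^j)..2^j} y) \<partial>lborel) \<le> ennreal (2 ^ (j * N))"
  proof (rule gaussian_test_growth[OF g])
    fix \<Psi> :: "real \<Rightarrow> real"
    assume \<Psi>: "schwartz \<Psi>" "\<And>y. \<Psi> y > 0"
    define c where "c = (LINT y|lborel. \<Psi> y)"
    have c: "c > 0" "mollifier (\<lambda>x. 1 / c * \<Psi> x)"
      unfolding c_def using mollifier_of_pos[OF \<Psi>] by auto
    from conv[OF c(2)] have "integrable lborel (\<lambda>y. h (0 - y) * rescale (\<lambda>x. 1 / c * \<Psi> x) 1 y)"
      unfolding convolution_exists_def by blast
    then have "integrable lborel (\<lambda>y. c * \<bar>h (0 - y) * rescale (\<lambda>x. 1 / c * \<Psi> x) 1 y\<bar>)" by simp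
    also have "(\<lambda>y. c * \<bar>h (0 - y) * rescale (\<lambda>x. 1 / c * \<Psi> x) 1 y\<bar>) = (\<lambda>y. g y * \<Psi> y)"
      using c(1) \<Psi>(2) by (auto simp: rescale_def g_def abs_mult less_imp_le)
    finally show "integrable lborel (\<lambda>y. g y * \<Psi> y)" .
  qed (simp add: g_def)
  then obtain N where "integrable lborel (\<lambda>y. g y / (1 + \<bar>y\<bar>) ^ Suc N)"
    using integrable_weight[OF g] by (auto simp: g_def)
  then have "integrable lborel (\<lambda>y. g (0 + (- 1) * y) / (1 + \<bar>0 + (- 1) * y\<bar>) ^ Suc N)"
    by (rule lborel_integrable_real_affine) simp
  then have "integrable lborel (\<lambda>y. \<bar>h y\<bar> / (1 + \<bar>y\<bar>) ^ Suc N)" by (simp add: g_def)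
  then have "integrable lborel (\<lambda>y. h y / (1 + \<bar>y\<bar>) ^ Suc N)"
    by (rule Bochner_Integration.integrable_bound) auto
  then show ?thesis ..
qed

section \<open>Convolution of tempered functions\<close>

text \<open>A form of Peetre's inequality, from \<open>1 + \<bar>y\<bar> \<le> (1 + \<bar>x\<bar>) *
  (1 + \<bar>x - y\<bar>)\<close>. It takes the translation by \<open>x\<close> out of the weight at
  the cost of a factor that is bounded for bounded \<open>x\<close>.\<close>

lemma inverse_weight_shift:
  fixes x y :: real
  shows "1 / (1 + \<bar>x - y\<bar>) ^ M \<le> (1 + \<bar>x\<bar>) ^ M / (1 + \<bar>y\<bar>) ^ M"
proof -
  have "1 + \<bar>y\<bar> \<le> 1 + \<bar>x\<bar> + \<bar>x - y\<bar> + \<bar>x\<bar> * \<bar>x - y\<bar>"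
    by (smt (verit) mult_nonneg_nonneg)
  also have "\<dots> = (1 + \<bar>x\<bar>) * (1 + \<bar>x - y\<bar>)" by (simp add: algebra_simps)
  finally have "(1 + \<bar>y\<bar>) ^ M \<le> ((1 + \<bar>x\<bar>) * (1 + \<bar>x - y\<bar>)) ^ M" by (intro power_mono) auto
  moreover have "1 + \<bar>y\<bar> > 0" "1 + \<bar>x - y\<bar> > 0" by linarith+
  ultimately show ?thesis
    unfolding power_mult_distrib by (simp add: divide_le_eq le_divide_eq mult.commute)
qed

text \<open>Here \<open>x\<close> occurs in the regular factor only, so limits in \<open>x\<close>
  act on \<open>\<phi>\<close> and not on \<open>h\<close>.\<close>

lemma convolution_alt:
  "convolution h \<phi> x = (LINT y|lborel. h y * \<phi> (x - y))"
  unfolding convolution_def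
  by (subst lborel_integral_real_affine[where c = "- 1" and t = x]) auto

context
  fixes h :: "real \<Rightarrow> real" and M :: nat
  assumes h[measurable]: "h \<in> borel_measurable borel"
    and tempered: "integrable lborel (\<lambda>y. h y / (1 + \<bar>y\<bar>) ^ M)"
begin

lemma tempered_dominant: "integrable lborel (\<lambda>y. B * (\<bar>h y\<bar> / (1 + \<bar>y\<bar>) ^ M))"
proof -
  have "integrable lborel (\<lambda>y. \<bar>h y / (1 + \<bar>y\<bar>) ^ M\<bar>)" using tempered by (rule integrable_abs)
  then have "integrable lborel (\<lambda>y. \<bar>h y\<bar> / (1 + \<bar>y\<bar>) ^ M)" by simp
  then show ?thesis by (rule integrable_mult_right)
qed

text \<open>One majorant serves all \<open>x\<close> with \<open>\<bar>x\<bar> \<le> R\<close>, as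
  dominated convergence along a convergent sequence of points requires.\<close>

lemma tempered_bound:
  assumes "\<And>y. \<bar>\<phi> y\<bar> \<le> C / (1 + \<bar>y\<bar>) ^ M" "C \<ge> 0" "\<bar>x\<bar> \<le> R"
  shows "\<bar>h y * \<phi> (x - y)\<bar> \<le> C * (1 + R) ^ M * (\<bar>h y\<bar> / (1 + \<bar>y\<bar>) ^ M)"
proof -
  have "\<bar>\<phi> (x - y)\<bar> \<le> C * (1 / (1 + \<bar>x - y\<bar>) ^ M)" using assms(1)[of "x - y"] by simp
  also have "\<dots> \<le> C * ((1 + \<bar>x\<bar>) ^ M / (1 + \<bar>y\<bar>) ^ M)"
    using assms(2) inverse_weight_shift by (intro mult_left_mono)
  also have "\<dots> \<le> C * ((1 + R) ^ M / (1 + \<bar>y\<bar>) ^ M)"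
    using assms(2,3) by (intro mult_left_mono divide_right_mono power_mono) auto
  finally have "\<bar>h y\<bar> * \<bar>\<phi> (x - y)\<bar> \<le> \<bar>h y\<bar> * (C * ((1 + R) ^ M / (1 + \<bar>y\<bar>) ^ M))"
    by (intro mult_left_mono) auto
  then show ?thesis by (simp add: abs_mult mult_ac)
qed

lemma tempered_integrable:
  assumes [measurable]: "\<phi> \<in> borel_measurable borel"
    and "\<And>y. \<bar>\<phi> y\<bar> \<le> C / (1 + \<bar>y\<bar>) ^ M" "C \<ge> 0"
  shows "integrable lborel (\<lambda>y. h y * \<phi> (x - y))"
  by (rule Bochner_Integration.integrable_bound[OF tempered_dominant[of "C * (1 + \<bar>x\<bar>) ^ M"]])
    (use order_trans[OF tempered_bound[OF assms(2,3) order_refl] abs_ge_self] in auto)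

lemma convolution_continuous:
  assumes cont: "continuous_on UNIV \<phi>"
    and dec: "\<And>y. \<bar>\<phi> y\<bar> \<le> C / (1 + \<bar>y\<bar>) ^ M" "C \<ge> 0"
  shows "continuous_on UNIV (convolution h \<phi>)"
proof -
  have [measurable]: "\<phi> \<in> borel_measurable borel" by (rule borel_measurable_continuous_onI[OF cont])
  have "isCont (convolution h \<phi>) x" for x
  proof (unfold continuous_at_sequentially comp_def, intro allI impI)
    fix X :: "nat \<Rightarrow> real" assume X: "X \<longlonglongrightarrow> x"
    then obtain R where R: "\<And>n. \<bar>X n\<bar> \<le> R"
      using convergent_imp_Bseq[of X] by (auto simp: convergent_def Bseq_def)
    show "(\<lambda>n. convolution h \<phi> (X n)) \<longlonglongrightarrow> convolution h \<phi> x"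
      unfolding convolution_alt
    proof (rule integral_dominated_convergence[where w = "\<lambda>y. C * (1 + R) ^ M * (\<bar>h y\<bar> / (1 + \<bar>y\<bar>) ^ M)"])
      show "AE y in lborel. (\<lambda>i. h y * \<phi> (X i - y)) \<longlonglongrightarrow> h y * \<phi> (x - y)"
      proof (intro AE_I2 tendsto_mult tendsto_const)
        fix y
        have "isCont \<phi> (x - y)" using cont by (simp add: continuous_on_eq_continuous_at)
        then show "(\<lambda>i. \<phi> (X i - y)) \<longlonglongrightarrow> \<phi> (x - y)"
          by (rule isCont_tendsto_compose) (intro tendsto_diff X tendsto_const)
      qed
      show "\<And>i. AE y in lborel. norm (h y * \<phi> (X i - y)) \<le> C * (1 + R) ^ M * (\<bar>h y\<bar> / (1 + \<bar>y\<bar>) ^ M)"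
        using tempered_bound[OF dec R] by simp
    qed (use tempered_dominant in simp_all)
  qed
  then show ?thesis by (simp add: continuous_on_eq_continuous_at)
qed

lemma convolution_DERIV:
  assumes der: "\<And>y. (\<phi> has_real_derivative \<phi>' y) (at y)"
    and cont: "continuous_on UNIV \<phi>'"
    and dec: "\<And>y. \<bar>\<phi> y\<bar> \<le> C / (1 + \<bar>y\<bar>) ^ M" "C \<ge> 0"
    and dec': "\<And>y. \<bar>\<phi>' y\<bar> \<le> C' / (1 + \<bar>y\<bar>) ^ M" "C' \<ge> 0"
  shows "(convolution h \<phi> has_real_derivative convolution h \<phi>' x) (at x)"
proof -
  have c: "continuous_on UNIV \<phi>" by (rule DERIV_continuous_UNIV[OF der])
  have [measurable]: "\<phi> \<in> borel_measurable borel" "\<phi>' \<in> borel_measurable borel"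
    by (intro borel_measurable_continuous_onI c cont)+
  note int = tempered_integrable[OF _ dec]
  show ?thesis
    unfolding has_field_derivative_iff tendsto_at_iff_sequentially comp_def
  proof (intro allI impI)
    fix X :: "nat \<Rightarrow> real" assume X: "\<forall>i. X i \<in> UNIV - {x}" "X \<longlonglongrightarrow> x"
    have ne: "X i \<noteq> x" for i using X(1) by simp
    obtain R where R: "\<And>n. \<bar>X n\<bar> \<le> R"
      using convergent_imp_Bseq[of X] X(2) by (auto simp: convergent_def Bseq_def)
    have xR: "\<bar>x\<bar> \<le> R"
      using tendsto_rabs[OF X(2)] by (rule LIMSEQ_le_const2) (use R in auto)
    have eq: "(convolution h \<phi> (X i) - convolution h \<phi> x) / (X i - x) =
        (LINT y|lborel. h y * ((\<phi> (X i - y) - \<phi> (x - y)) / (X i - x)))" for i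
    proof -
      have "(convolution h \<phi> (X i) - convolution h \<phi> x) / (X i - x) =
        (LINT y|lborel. (h y * \<phi> (X i - y) - h y * \<phi> (x - y)) / (X i - x))"
        unfolding convolution_alt
        by (simp only: integral_divide_zero Bochner_Integration.integral_diff[OF int int] \<open>\<phi> \<in> borel_measurable borel\<close>)
      then show ?thesis by (simp add: algebra_simps)
    qed
    show "(\<lambda>i. (convolution h \<phi> (X i) - convolution h \<phi> x) / (X i - x)) \<longlonglongrightarrow> convolution h \<phi>' x"
      unfolding eq unfolding convolution_alt
    proof (rule integral_dominated_convergence[where w = "\<lambda>y. C' * (1 + R) ^ M * (\<bar>h y\<bar> / (1 + \<bar>y\<bar>) ^ M)"])
      show "AE y in lborel. (\<lambda>i. h y * ((\<phi> (X i - y) - \<phi> (x - y)) / (X i - x))) \<longlonglongrightarrow> h y * \<phi>' (x - y)"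
      proof (intro AE_I2 tendsto_mult tendsto_const)
        fix y
        have "((\<lambda>x. \<phi> (x - y)) has_real_derivative \<phi>' (x - y) * 1) (at x)"
          by (rule DERIV_chain'[OF _ der]) (auto intro!: derivative_eq_intros)
        then show "(\<lambda>i. (\<phi> (X i - y) - \<phi> (x - y)) / (X i - x)) \<longlonglongrightarrow> \<phi>' (x - y)"
          unfolding has_field_derivative_iff tendsto_at_iff_sequentially comp_def using X by simp
      qed
      fix i
      show "AE y in lborel. norm (h y * ((\<phi> (X i - y) - \<phi> (x - y)) / (X i - x)))
          \<le> C' * (1 + R) ^ M * (\<bar>h y\<bar> / (1 + \<bar>y\<bar>) ^ M)"
      proof (intro AE_I2)
        fix y
        \<comment> \<open>By the mean value theorem the difference quotient is a value of
          \<open>\<phi>'\<close> at a point whose \<open>z\<close> lies between \<open>X i\<close>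
          and \<open>x\<close>, so the majorant belonging to \<open>\<phi>'\<close> applies.\<close>
        obtain z where z: "min (X i) x \<le> z" "z \<le> max (X i) x"
          "\<phi> (X i - y) - \<phi> (x - y) = (X i - x) * \<phi>' (z - y)"
        proof -
          have d: "((\<lambda>t. \<phi> (t - y)) has_real_derivative \<phi>' (t - y)) (at t)" for t
            using DERIV_chain'[OF DERIV_diff[OF DERIV_ident DERIV_const] der] by simp
          show ?thesis
          proof (cases "X i < x")
            case True
            then obtain z where z: "z > X i" "z < x" "\<phi> (x - y) - \<phi> (X i - y) = (x - X i) * \<phi>' (z - y)"
              using MVT2[OF True d] by blast
            show ?thesis by (rule that[of z]) (use z in \<open>auto simp: algebra_simps\<close>)
          next
            case False
            then have "x < X i" using ne[of i] by simp
            then obtain z where z: "z > x" "z < X i" "\<phi> (X i - y) - \<phi> (x - y) = (X i - x) * \<phi>' (z - y)"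
              using MVT2[OF _ d] by blast
            show ?thesis by (rule that[of z]) (use z in auto)
          qed
        qed
        have "\<bar>z\<bar> \<le> R" using z R[of i] xR by linarith
        from tempered_bound[OF dec' this]
        show "norm (h y * ((\<phi> (X i - y) - \<phi> (x - y)) / (X i - x)))
          \<le> C' * (1 + R) ^ M * (\<bar>h y\<bar> / (1 + \<bar>y\<bar>) ^ M)"
          using z(3) ne[of i] by simp
      qed
    qed (use tempered_dominant in simp_all)
  qed
qed

end

text \<open>Without compact support of \<open>\<Phi>\<close> the integral has to be split at
  \<open>\<bar>x - y\<bar> = \<delta>\<close>. Near \<open>x\<close>, uniform continuity of
  \<open>h\<close> gives \<open>\<eta> * I\<close>, with the integral \<open>I\<close> of
  \<open>\<bar>\<Phi>\<bar>\<close> in place of 1 because \<open>\<Phi>\<close> may change sign. Far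
  from \<open>x\<close>, the decay of \<open>\<Phi>\<close> gains a factor \<open>1 / real n\<close>
  against a weight that makes both \<open>h\<close> and constants integrable.\<close>

lemma convolution_rescale_uniform_limit:
  assumes cont: "continuous_on UNIV h"
    and temp: "integrable lborel (\<lambda>y. h y / (1 + \<bar>y\<bar>) ^ M)"
    and moll: "mollifier \<Phi>" and S: "compact S"
  shows "uniform_limit S (\<lambda>n. convolution h (rescale \<Phi> n)) h sequentially"
proof (rule uniform_limitI)
  fix e :: real assume e: "e > 0"
  have h[measurable]: "h \<in> borel_measurable borel" by (rule borel_measurable_continuous_onI[OF cont])
  have schw: "schwartz \<Phi>" and int1: "(LINT x|lborel. \<Phi> x) = 1" using moll by (auto simp: mollifier_def)
  have [measurable]: "\<Phi> \<in> borel_measurable borel" using schwartz_borel[OF schw, of 0] by simp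
  have \<Phi>_int: "integrable lborel \<Phi>" by (rule schwartz_integrable[OF schw])
  \<comment> \<open>The exponent \<open>M\<close> is for \<open>h\<close> and 3 is for the constant
    \<open>H\<close>; moreover \<open>N \<ge> 2\<close> gives
    \<open>real n / real n ^ N \<le> 1 / real n\<close>.\<close>
  define N where "N = max M 3"
  have tempN: "integrable lborel (\<lambda>y. h y / (1 + \<bar>y\<bar>) ^ N)"
    by (rule integrable_weight_mono[OF temp]) (auto simp: N_def)
  have oneN: "integrable lborel (\<lambda>y::real. 1 / (1 + \<bar>y\<bar>) ^ N)"
    by (rule integrable_weight_mono[OF integrable_weight_3]) (auto simp: N_def)
  obtain D where D: "D \<ge> 0" "\<And>y. \<bar>\<Phi> y\<bar> \<le> D / (1 + \<bar>y\<bar>) ^ N"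
    using schwartz_decay[OF schw, of 0 N] by auto
  obtain R where R: "R \<ge> 0" "\<And>x. x \<in> S \<Longrightarrow> \<bar>x\<bar> \<le> R"
    using compact_imp_bounded[OF S] unfolding bounded_iff real_norm_def
    by (metis abs_ge_zero linorder_linear order_trans)
  obtain H where H: "H \<ge> 0" "\<And>x. \<bar>x\<bar> \<le> R \<Longrightarrow> \<bar>h x\<bar> \<le> H"
  proof -
    have "compact (h ` {-R..R})" by (intro compact_continuous_image continuous_on_subset[OF cont]) auto
    then obtain H where "\<And>x. x \<in> {-R..R} \<Longrightarrow> \<bar>h x\<bar> \<le> H"
      using compact_imp_bounded by (force simp: bounded_iff)
    moreover have "x \<in> {-R..R}" if "\<bar>x\<bar> \<le> R" for x using that by auto
    ultimately have "\<bar>h x\<bar> \<le> \<bar>H\<bar>" if "\<bar>x\<bar> \<le> R" for x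
      using that by (meson abs_ge_self order_trans)
    then show ?thesis using that[of "\<bar>H\<bar>"] by auto
  qed
  define I where "I = (LINT y|lborel. \<bar>\<Phi> y\<bar>)"
  have I: "I \<ge> 0" by (simp add: I_def)
  define \<eta> where "\<eta> = e / (2 * (I + 1))"
  have \<eta>: "\<eta> > 0" "\<eta> * I < e / 2"
    using e I by (auto simp: \<eta>_def field_simps add_pos_nonneg)
  have "uniformly_continuous_on {-R-1..R+1} h"
    by (intro compact_uniformly_continuous continuous_on_subset[OF cont]) auto
  then obtain \<delta>0 where \<delta>0: "\<delta>0 > 0"
    "\<And>x y. x \<in> {-R-1..R+1} \<Longrightarrow> y \<in> {-R-1..R+1} \<Longrightarrow> dist y x < \<delta>0 \<Longrightarrow> dist (h y) (h x) < \<eta>"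
    using \<eta>(1) unfolding uniformly_continuous_on_def by metis
  define \<delta> where "\<delta> = min (\<delta>0 / 2) 1"
  have \<delta>: "\<delta> > 0" "\<delta> \<le> 1" "\<delta> < \<delta>0" using \<delta>0(1) by (auto simp: \<delta>_def)
  \<comment> \<open>For \<open>t > \<delta>\<close> and \<open>\<delta> \<le> 1\<close> one has
    \<open>1 + real n * t \<ge> real n * (\<delta> / 2) * (1 + t)\<close>; the \<open>N\<close>-th
    power of this in the denominator produces \<open>(2 / \<delta>) ^ N\<close>.\<close>
  define A where "A = D * (2 / \<delta>) ^ N"
  have A: "A \<ge> 0" using D \<delta> by (simp add: A_def)
  define B where "B = A * (1 + R) ^ N * ((LINT y|lborel. \<bar>h y\<bar> / (1 + \<bar>y\<bar>) ^ N) + H * (LINT y|lborel. 1 / (1 + \<bar>y\<bar>) ^ N))"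
  obtain n0 :: nat where n0: "real n0 > 2 * B / e" using reals_Archimedean2 by blast
  show "\<forall>\<^sub>F n in sequentially. \<forall>x\<in>S. dist (convolution h (rescale \<Phi> n) x) (h x) < e"
  proof (rule eventually_sequentiallyI[of "max 1 n0"], intro ballI)
    fix n x assume n: "n \<ge> max 1 n0" and x: "x \<in> S"
    have n1: "real n \<ge> 1" and n2: "real n > 2 * B / e" using n n0 by auto
    have xR: "\<bar>x\<bar> \<le> R" using R x by simp
    define \<phi> where "\<phi> = rescale \<Phi> n"
    have [measurable]: "\<phi> \<in> borel_measurable borel" unfolding \<phi>_def rescale_def by measurable
    have \<phi>_alt: "\<phi> (x - y) = real n * \<Phi> (real n * x + (- real n) * y)" for y
      by (simp add: \<phi>_def rescale_def algebra_simps)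
    have \<phi>_int: "integrable lborel (\<lambda>y. \<phi> (x - y))"
      unfolding \<phi>_alt using n1 by (intro integrable_mult_right lborel_integrable_real_affine \<Phi>_int) auto
    have \<phi>1: "(LINT y|lborel. \<phi> (x - y)) = 1"
      unfolding \<phi>_alt using n1 lborel_integral_real_affine[of "- real n" \<Phi> "real n * x"] int1 by simp
    have \<phi>I: "(LINT y|lborel. \<bar>\<phi> (x - y)\<bar>) = I"
      unfolding \<phi>_alt I_def
      using n1 lborel_integral_real_affine[of "- real n" "\<lambda>x. \<bar>\<Phi> x\<bar>" "real n * x"] by (simp add: abs_mult)
    have \<phi>_dec: "\<bar>\<phi> y\<bar> \<le> real n * D / (1 + real n * \<bar>y\<bar>) ^ N" for y
    proof -
      have "\<bar>\<phi> y\<bar> = real n * \<bar>\<Phi> (real n * y)\<bar>" by (simp add: \<phi>_def rescale_def abs_mult)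
      also have "\<dots> \<le> real n * (D / (1 + \<bar>real n * y\<bar>) ^ N)" using D(2) by (intro mult_left_mono) auto
      finally show ?thesis by (simp add: abs_mult)
    qed
    have \<phi>_dec1: "\<bar>\<phi> y\<bar> \<le> real n * D / (1 + \<bar>y\<bar>) ^ N" for y
    proof -
      have "1 * \<bar>y\<bar> \<le> real n * \<bar>y\<bar>" by (intro mult_right_mono n1) auto
      then have "real n * D / (1 + real n * \<bar>y\<bar>) ^ N \<le> real n * D / (1 + \<bar>y\<bar>) ^ N"
        using D(1) n1 by (intro divide_left_mono power_mono mult_pos_pos zero_less_power) (auto simp: add_pos_nonneg)
      then show ?thesis using \<phi>_dec[of y] by linarith
    qed
    have h\<phi>_int: "integrable lborel (\<lambda>y. h y * \<phi> (x - y))"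
      by (rule tempered_integrable[OF h tempN _ \<phi>_dec1]) (use D n1 in auto)
    have "convolution h \<phi> x - h x = (LINT y|lborel. h y * \<phi> (x - y)) - (LINT y|lborel. h x * \<phi> (x - y))"
      by (simp add: convolution_alt \<phi>1)
    also have "\<dots> = (LINT y|lborel. h y * \<phi> (x - y) - h x * \<phi> (x - y))"
      by (rule Bochner_Integration.integral_diff[symmetric]) (auto intro: h\<phi>_int \<phi>_int)
    finally have eq: "convolution h \<phi> x - h x = (LINT y|lborel. h y * \<phi> (x - y) - h x * \<phi> (x - y))" .
    define E where "E = A * (1 + R) ^ N / real n"
    have E: "E \<ge> 0" using A R n1 by (simp add: E_def)
    let ?w = "\<lambda>y. \<eta> * \<bar>\<phi> (x - y)\<bar> + E * (\<bar>h y\<bar> / (1 + \<bar>y\<bar>) ^ N + H * (1 / (1 + \<bar>y\<bar>) ^ N))"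
    have habs: "integrable lborel (\<lambda>y. \<bar>h y\<bar> / (1 + \<bar>y\<bar>) ^ N)"
      using tempered_dominant[OF h tempN, of 1] by simp
    have w_int: "integrable lborel ?w"
      by (intro Bochner_Integration.integrable_add integrable_mult_right integrable_abs \<phi>_int habs oneN)
    have bound: "norm (h y * \<phi> (x - y) - h x * \<phi> (x - y)) \<le> ?w y" for y
    proof -
      have eqn: "norm (h y * \<phi> (x - y) - h x * \<phi> (x - y)) = \<bar>h y - h x\<bar> * \<bar>\<phi> (x - y)\<bar>"
        by (simp add: abs_mult[symmetric] left_diff_distrib)
      have p2: "E * (\<bar>h y\<bar> / (1 + \<bar>y\<bar>) ^ N + H * (1 / (1 + \<bar>y\<bar>) ^ N)) \<ge> 0"
        using E H by (intro mult_nonneg_nonneg add_nonneg_nonneg) auto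
      show ?thesis
      proof (cases "\<bar>x - y\<bar> \<le> \<delta>")
        case True
        have "dist (h y) (h x) < \<eta>"
          by (rule \<delta>0(2)) (use True \<delta> xR in \<open>auto simp: dist_real_def\<close>)
        then have "\<bar>h y - h x\<bar> * \<bar>\<phi> (x - y)\<bar> \<le> \<eta> * \<bar>\<phi> (x - y)\<bar>"
          by (intro mult_right_mono) (auto simp: dist_real_def)
        then show ?thesis using p2 unfolding eqn by linarith
      next
        case False
        define t where "t = \<bar>x - y\<bar>"
        have t: "t > \<delta>" using False by (simp add: t_def)
        have "real n * (\<delta> / 2) * (1 + t) \<le> 1 + real n * t"
        proof -
          have "\<delta> * t \<le> t" using \<delta> t mult_right_mono[of \<delta> 1 t] by simp
          then have "(\<delta> / 2) * (1 + t) \<le> t" using t by (simp add: field_simps)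
          then have "real n * ((\<delta> / 2) * (1 + t)) \<le> real n * t" by (intro mult_left_mono) auto
          then show ?thesis by (simp add: mult.assoc)
        qed
        then have "(real n * (\<delta> / 2) * (1 + t)) ^ N \<le> (1 + real n * t) ^ N"
          using n1 \<delta> t by (intro power_mono) auto
        then have "real n * D / (1 + real n * t) ^ N \<le> real n * D / (real n * (\<delta> / 2) * (1 + t)) ^ N"
          using n1 \<delta> t D by (intro divide_left_mono mult_nonneg_nonneg mult_pos_pos zero_less_power) (auto simp: add_pos_nonneg)
        also have "\<dots> = A * (real n / real n ^ N) * (1 / (1 + t) ^ N)"
          unfolding A_def power_mult_distrib power_divide using n1 \<delta> t by (simp add: divide_simps)
        also have "\<dots> \<le> A * (1 / real n) * (1 / (1 + t) ^ N)"
        proof -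
          have "real n ^ 2 \<le> real n ^ N" using n1 by (intro power_increasing) (auto simp: N_def)
          then have "real n / real n ^ N \<le> real n / real n ^ 2"
            using n1 by (intro divide_left_mono) auto
          also have "\<dots> = 1 / real n" by (simp add: power2_eq_square)
          finally show ?thesis using A t \<delta> by (intro mult_right_mono mult_left_mono) auto
        qed
        also have "\<dots> \<le> A * (1 / real n) * ((1 + \<bar>x\<bar>) ^ N / (1 + \<bar>y\<bar>) ^ N)"
          unfolding t_def using A by (intro mult_left_mono inverse_weight_shift) auto
        also have "\<dots> \<le> A * (1 / real n) * ((1 + R) ^ N / (1 + \<bar>y\<bar>) ^ N)"
          using A xR by (intro mult_left_mono divide_right_mono power_mono) auto
        also have "\<dots> = E * (1 / (1 + \<bar>y\<bar>) ^ N)" by (simp add: E_def)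
        finally have "\<bar>\<phi> (x - y)\<bar> \<le> E * (1 / (1 + \<bar>y\<bar>) ^ N)"
          using \<phi>_dec[of "x - y"] unfolding t_def by linarith
        moreover have "\<bar>h y - h x\<bar> \<le> \<bar>h y\<bar> + H" using H(2)[OF xR] by linarith
        ultimately have "\<bar>h y - h x\<bar> * \<bar>\<phi> (x - y)\<bar> \<le> (\<bar>h y\<bar> + H) * (E * (1 / (1 + \<bar>y\<bar>) ^ N))"
          using H by (intro mult_mono) auto
        also have "\<dots> = E * (\<bar>h y\<bar> / (1 + \<bar>y\<bar>) ^ N + H * (1 / (1 + \<bar>y\<bar>) ^ N))"
          by (simp add: algebra_simps add_divide_distrib)
        also have "\<dots> \<le> ?w y" using \<eta>(1) by simp
        finally show ?thesis unfolding eqn .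
      qed
    qed
    have "norm (LINT y|lborel. h y * \<phi> (x - y) - h x * \<phi> (x - y)) \<le> (LINT y|lborel. ?w y)"
      by (rule Bochner_Integration.integral_norm_bound_integral[OF _ w_int bound])
        (intro Bochner_Integration.integrable_diff h\<phi>_int integrable_mult_right \<phi>_int)
    also have "\<dots> = (LINT y|lborel. \<eta> * \<bar>\<phi> (x - y)\<bar>) +
        (LINT y|lborel. E * (\<bar>h y\<bar> / (1 + \<bar>y\<bar>) ^ N + H * (1 / (1 + \<bar>y\<bar>) ^ N)))"
      by (intro Bochner_Integration.integral_add Bochner_Integration.integrable_add integrable_mult_right
          integrable_abs \<phi>_int habs oneN)
    also have "\<dots> = \<eta> * I + E * ((LINT y|lborel. \<bar>h y\<bar> / (1 + \<bar>y\<bar>) ^ N) + H * (LINT y|lborel. 1 / (1 + \<bar>y\<bar>) ^ N))"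
      by (simp only: integral_mult_right_zero \<phi>I
          Bochner_Integration.integral_add[OF habs integrable_mult_right[OF oneN]])
    also have "\<dots> = \<eta> * I + B / real n" by (simp add: B_def E_def)
    also have "\<dots> < e / 2 + e / 2"
    proof -
      have "2 * B < real n * e" using n2 e by (simp add: divide_less_eq)
      then have "B / real n < e / 2" using n1 by (simp add: divide_less_eq mult.commute)
      then show ?thesis using \<eta>(2) by linarith
    qed
    finally show "dist (convolution h (rescale \<Phi> n) x) (h x) < e"
      unfolding dist_norm \<phi>_def[symmetric] eq by simp
  qed
qed

text \<open>Dilation by \<open>n \<ge> 1\<close> only improves the decay. The function estimated is
  the \<open>k\<close>-th derivative of \<open>rescale \<Phi> n\<close>; its constant depends on
  \<open>n\<close>, which is harmless since the bound serves regularity at a fixed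
  \<open>n\<close>.\<close>

lemma rescale_bound:
  assumes "schwartz \<Phi>" "n \<ge> 1"
  obtains C where "C \<ge> 0" "\<And>y. \<bar>real n ^ Suc k * (deriv ^^ k) \<Phi> (real n * y)\<bar> \<le> C / (1 + \<bar>y\<bar>) ^ M"
proof -
  obtain D where D: "D \<ge> 0" "\<And>y. \<bar>(deriv ^^ k) \<Phi> y\<bar> \<le> D / (1 + \<bar>y\<bar>) ^ M"
    using schwartz_decay[OF assms(1)] by blast
  have "\<bar>real n ^ Suc k * (deriv ^^ k) \<Phi> (real n * y)\<bar> \<le> real n ^ Suc k * D / (1 + \<bar>y\<bar>) ^ M" for y
  proof -
    have "1 * \<bar>y\<bar> \<le> real n * \<bar>y\<bar>" using assms(2) by (intro mult_right_mono) auto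
    then have "D / (1 + \<bar>real n * y\<bar>) ^ M \<le> D / (1 + \<bar>y\<bar>) ^ M"
      using D(1) assms(2) by (intro divide_left_mono power_mono mult_pos_pos zero_less_power) (auto simp: abs_mult add_pos_nonneg)
    with D(2)[of "real n * y"] have "\<bar>(deriv ^^ k) \<Phi> (real n * y)\<bar> \<le> D / (1 + \<bar>y\<bar>) ^ M" by linarith
    then have "real n ^ Suc k * \<bar>(deriv ^^ k) \<Phi> (real n * y)\<bar> \<le> real n ^ Suc k * (D / (1 + \<bar>y\<bar>) ^ M)"
      by (intro mult_left_mono) auto
    then show ?thesis by (simp add: abs_mult)
  qed
  then show ?thesis using that[of "real n ^ Suc k * D"] D(1) by simp
qed

lemma convolution_rescale_C1:
  assumes cont: "continuous_on UNIV h"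
    and temp: "integrable lborel (\<lambda>y. h y / (1 + \<bar>y\<bar>) ^ M)"
    and moll: "mollifier \<Phi>" and n: "n \<ge> 1"
  shows "continuous_on UNIV (convolution h (rescale \<Phi> n))"
    and "(convolution h (rescale \<Phi> n) has_real_derivative deriv (convolution h (rescale \<Phi> n)) x) (at x)"
    and "continuous_on UNIV (deriv (convolution h (rescale \<Phi> n)))"
proof -
  have h: "h \<in> borel_measurable borel" by (rule borel_measurable_continuous_onI[OF cont])
  have schw: "schwartz \<Phi>" using moll by (simp add: mollifier_def)
  define \<phi>' where "\<phi>' = (\<lambda>x. real n ^ Suc 1 * (deriv ^^ 1) \<Phi> (real n * x))"
  have c: "continuous_on UNIV \<phi>'" unfolding \<phi>'_def
    by (intro continuous_intros continuous_on_compose2[OF schwartz_continuous[OF schw]]) auto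
  have d: "(rescale \<Phi> n has_real_derivative \<phi>' y) (at y)" for y
  proof -
    have "((\<lambda>y. \<Phi> (real n * y)) has_real_derivative (deriv ^^ 1) \<Phi> (real n * y) * real n) (at y)"
      by (rule DERIV_chain'[OF _ schwartz_DERIV[OF schw, of 0, simplified funpow_0 One_nat_def[symmetric]]])
        (auto intro!: derivative_eq_intros)
    from DERIV_cmult[OF this, of "real n"] show ?thesis
      unfolding rescale_def \<phi>'_def by (simp add: mult_ac)
  qed
  obtain C0 where C0: "C0 \<ge> 0" "\<And>y. \<bar>rescale \<Phi> n y\<bar> \<le> C0 / (1 + \<bar>y\<bar>) ^ M"
    using rescale_bound[OF schw n, of 0 M] unfolding rescale_def by auto
  obtain C1 where C1: "C1 \<ge> 0" "\<And>y. \<bar>\<phi>' y\<bar> \<le> C1 / (1 + \<bar>y\<bar>) ^ M"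
    using rescale_bound[OF schw n, of 1 M] unfolding \<phi>'_def by blast
  have D: "(convolution h (rescale \<Phi> n) has_real_derivative convolution h \<phi>' x) (at x)" for x
    by (rule convolution_DERIV[OF h temp d c C0(2,1) C1(2,1)])
  then show "continuous_on UNIV (convolution h (rescale \<Phi> n))"
    by (rule DERIV_continuous_UNIV)
  have eq: "deriv (convolution h (rescale \<Phi> n)) = convolution h \<phi>'"
    using D by (auto intro!: DERIV_imp_deriv)
  show "(convolution h (rescale \<Phi> n) has_real_derivative deriv (convolution h (rescale \<Phi> n)) x) (at x)"
    unfolding eq by (rule D)
  show "continuous_on UNIV (deriv (convolution h (rescale \<Phi> n)))"
    unfolding eq by (rule convolution_continuous[OF h temp c C1(2,1)])
qed

section \<open>Primitives and uniform limits\<close>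

text \<open>Continuity is asked on an interval only, because the integrand will be
  \<open>\<beta>\<^sub>n' / \<sigma>\<^sub>n\<^sup>2\<close>, whose denominator may vanish far
  out.\<close>

lemma LBINT_DERIV_on:
  fixes g :: "real \<Rightarrow> real"
  assumes "continuous_on {a..b} g" "a \<le> 0" "0 \<le> b" "a < x" "x < b"
  shows "((\<lambda>x. LBINT y=0..x. g y) has_real_derivative g x) (at x)"
proof -
  have "((\<lambda>u. LBINT y=ereal 0..ereal u. g y) has_vector_derivative g x) (at x within {a..b})"
    using assms by (intro interval_integral_FTC2) auto
  moreover have "at x within {a..b} = at x" using assms by (intro at_within_Icc_at)
  ultimately show ?thesis
    by (simp add: has_real_derivative_iff_has_vector_derivative zero_ereal_def)
qed

lemma LBINT_DERIV:
  fixes g :: "real \<Rightarrow> real"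
  assumes "continuous_on UNIV g"
  shows "((\<lambda>x. LBINT y=0..x. g y) has_real_derivative g x) (at x)"
  by (rule LBINT_DERIV_on[of "- \<bar>x\<bar> - 1" "\<bar>x\<bar> + 1"]) (auto intro: continuous_on_subset[OF assms])

lemma uniform_limit_antideriv:
  fixes F :: "nat \<Rightarrow> real \<Rightarrow> real"
  assumes F: "\<And>n x. (F n has_real_derivative F' n x) (at x)"
    and G: "\<And>x. (G has_real_derivative G' x) (at x)"
    and 0: "\<And>n. F n 0 = G 0"
    and lim: "uniform_limit {-R..R} F' G' sequentially"
  shows "uniform_limit {-R..R} F G sequentially"
proof (cases "R \<ge> 0")
  case True
  have main: "\<forall>\<^sub>F n in sequentially. \<forall>x\<in>{-R..R}. dist (F n x) (G x) < e" if "e > 0" for e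
  proof -
    \<comment> \<open>Dividing by \<open>R + 1\<close> instead of \<open>R\<close> covers
      \<open>R = 0\<close> and makes the final estimate strict.\<close>
    have e: "e / (R + 1) > 0" using that True by (intro divide_pos_pos) auto
    have "\<forall>\<^sub>F n in sequentially. \<forall>x\<in>{-R..R}. dist (F' n x) (G' x) < e / (R + 1)"
      by (rule uniform_limitD[OF lim e])
    then show ?thesis
    proof (rule eventually_mono, intro ballI)
      fix n x
      assume n: "\<forall>x\<in>{-R..R}. dist (F' n x) (G' x) < e / (R + 1)" and x: "x \<in> {-R..R}"
      have "norm ((F n x - G x) - (F n 0 - G 0)) \<le> e / (R + 1) * norm (x - 0)"
      proof (rule field_differentiable_bound[where S = "{-R..R}"])
        show "((\<lambda>x. F n x - G x) has_real_derivative F' n z - G' z) (at z within {-R..R})" for z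
          by (rule has_field_derivative_at_within[OF DERIV_diff[OF F G]])
        show "norm (F' n z - G' z) \<le> e / (R + 1)" if "z \<in> {-R..R}" for z
          using n that by (simp only: dist_norm less_imp_le)
      qed (use x True in auto)
      also have "\<dots> \<le> e / (R + 1) * R" using x e by (intro mult_left_mono) auto
      also have "\<dots> < e" using \<open>e > 0\<close> True by (simp add: field_simps)
      finally show "dist (F n x) (G x) < e" by (simp add: 0 dist_real_def)
    qed
  qed
  then show ?thesis by (rule uniform_limitI)
qed auto

text \<open>\<open>H\<close> is merely a pointwise limit. With \<open>G\<close> a primitive of
  \<open>g\<close>, the mean value inequality makes \<open>F n - G\<close> nearly constant on the
  interval, so \<open>H - G\<close> is constant there. Differentiability of \<open>F n\<close> is
  assumed eventually because \<open>\<sigma>\<^sub>n\<^sup>2\<close> may vanish for small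
  \<open>n\<close>.\<close>

lemma uniform_limit_DERIV:
  fixes F :: "nat \<Rightarrow> real \<Rightarrow> real"
  assumes F: "\<forall>\<^sub>F n in sequentially. \<forall>x\<in>{-R..R}. (F n has_real_derivative F' n x) (at x)"
    and lim: "uniform_limit {-R..R} F' g sequentially"
    and cont: "continuous_on UNIV g"
    and H: "\<And>x. x \<in> {-R..R} \<Longrightarrow> (\<lambda>n. F n x) \<longlonglongrightarrow> H x"
    and x: "\<bar>x\<bar> < R"
  shows "(H has_real_derivative g x) (at x)"
proof -
  define G :: "real \<Rightarrow> real" where "G = (\<lambda>x. LBINT y=0..x. g y)"
  have G: "(G has_real_derivative g x) (at x)" for x unfolding G_def by (rule LBINT_DERIV[OF cont])
  have R: "R > 0" using x by linarith
  have H_eq: "H z = H 0 - G 0 + G z" if z: "z \<in> {-R..R}" for z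
  proof -
    have "(\<lambda>n. (F n z - G z) - (F n 0 - G 0)) \<longlonglongrightarrow> 0"
    proof (rule LIMSEQ_I)
      fix e :: real assume "e > 0"
      then have e: "e / (R + 1) > 0" using R by (intro divide_pos_pos) auto
      from uniform_limitD[OF lim e] F
      have "\<forall>\<^sub>F n in sequentially. norm ((F n z - G z) - (F n 0 - G 0) - 0) < e"
      proof eventually_elim
        case (elim n)
        have "norm ((F n z - G z) - (F n 0 - G 0)) \<le> e / (R + 1) * norm (z - 0)"
        proof (rule field_differentiable_bound[where S = "{-R..R}"])
          show "((\<lambda>x. F n x - G x) has_real_derivative F' n u - g u) (at u within {-R..R})" if "u \<in> {-R..R}" for u
            using elim that by (intro has_field_derivative_at_within[OF DERIV_diff[OF _ G]]) auto
        qed (use elim z R in \<open>auto simp: dist_real_def less_imp_le\<close>)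
        also have "\<dots> \<le> e / (R + 1) * R" using z e by (intro mult_left_mono) auto
        also have "\<dots> < e" using \<open>e > 0\<close> R by (simp add: field_simps)
        finally show ?case by simp
      qed
      then show "\<exists>no. \<forall>n\<ge>no. norm ((F n z - G z) - (F n 0 - G 0) - 0) < e"
        by (simp add: eventually_sequentially)
    qed
    moreover have "(\<lambda>n. (F n z - G z) - (F n 0 - G 0)) \<longlonglongrightarrow> (H z - G z) - (H 0 - G 0)"
      using z R by (intro tendsto_diff H tendsto_const) auto
    ultimately have "(H z - G z) - (H 0 - G 0) = 0" by (metis LIMSEQ_unique)
    then show ?thesis by simp
  qed
  have D: "((\<lambda>z. H 0 - G 0 + G z) has_real_derivative g x) (at x)"
    using DERIV_add[OF DERIV_const G] by simp
  show ?thesis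
  proof (rule has_field_derivative_transform_within_open[OF D])
    show "x \<in> {-R<..<R}" using x by auto
    show "H 0 - G 0 + G z = H z" if "z \<in> {-R<..<R}" for z using H_eq[of z] that by simp
  qed simp
qed

lemma bounded_continuous_image:
  fixes g :: "real \<Rightarrow> real"
  assumes "continuous_on UNIV g"
  shows "bounded (g ` {a..b})"
  by (intro compact_imp_bounded compact_continuous_image continuous_on_subset[OF assms]) auto

text \<open>\<open>exp\<close> is uniformly continuous on bounded sets only; the margin 1 in
  \<open>{-B-1..B+1}\<close> leaves room for \<open>f n\<close>, eventually within 1 of
  \<open>g\<close>.\<close>

lemma uniform_limit_exp:
  fixes f :: "nat \<Rightarrow> real \<Rightarrow> real"
  assumes lim: "uniform_limit X f g sequentially" and bdd: "bounded (g ` X)"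
  shows "uniform_limit X (\<lambda>n x. exp (f n x)) (\<lambda>x. exp (g x)) sequentially"
proof -
  obtain B where B: "\<And>x. x \<in> X \<Longrightarrow> \<bar>g x\<bar> \<le> B" using bdd by (auto simp: bounded_iff)
  have "uniform_limit X (\<lambda>n x. exp (f n x)) (exp \<circ> g) sequentially"
  proof (rule uniform_limit_compose[OF lim, where U = "{-B-1..B+1}"])
    show "uniformly_continuous_on {-B-1..B+1} (exp :: real \<Rightarrow> real)"
      by (intro compact_uniformly_continuous continuous_intros) auto
    show "\<forall>\<^sub>F n in sequentially. f n ` X \<subseteq> {-B-1..B+1}"
      using uniform_limitD[OF lim zero_less_one]
    proof eventually_elim
      case (elim n)
      show ?case
      proof (intro image_subsetI)
        fix x assume "x \<in> X"
        then have "\<bar>f n x - g x\<bar> < 1" "\<bar>g x\<bar> \<le> B" using elim B by (auto simp: dist_real_def)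
        then have "\<bar>f n x\<bar> \<le> B + 1" by linarith
        then show "f n x \<in> {-B-1..B+1}" by auto
      qed
    qed
    show "g ` X \<subseteq> {-B-1..B+1}"
    proof (intro image_subsetI)
      fix x assume "x \<in> X"
      then have "\<bar>g x\<bar> \<le> B" by (rule B)
      then show "g x \<in> {-B-1..B+1}" by auto
    qed
  qed
  then show ?thesis by (simp add: comp_def)
qed

section \<open>Functions of class C^k and convergence on compact sets\<close>

lemma Ck_1I:
  assumes "\<And>x. (f has_real_derivative v x) (at x)" "continuous_on UNIV v"
  shows "Ck 1 f" "deriv f = v"
proof -
  show v: "deriv f = v" using assms(1) by (auto intro!: DERIV_imp_deriv)
  show "Ck 1 f" using assms by (auto simp: Ck_def v field_differentiable_def)
qed

lemma Ck_2I:
  assumes "\<And>x. (f has_real_derivative v x) (at x)" "\<And>x. (v has_real_derivative w x) (at x)" "continuous_on UNIV w"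
  shows "Ck 2 f" "deriv f = v" "deriv v = w"
proof -
  show v: "deriv f = v" using assms(1) by (auto intro!: DERIV_imp_deriv)
  show w: "deriv v = w" using assms(2) by (auto intro!: DERIV_imp_deriv)
  show "Ck 2 f" using assms by (auto simp: Ck_def v w field_differentiable_def numeral_2_eq_2 less_Suc_eq)
qed

lemma Ck_2D:
  assumes "Ck 2 f"
  shows "(deriv f has_real_derivative deriv (deriv f) x) (at x)"
proof -
  have "(deriv ^^ 1) f field_differentiable at x"
    using assms unfolding Ck_def by (metis one_less_numeral_iff semiring_norm(76))
  then show ?thesis by (simp add: field_differentiable_derivI)
qed

lemma Ck_1D:
  assumes "Ck 1 f"
  shows "(f has_real_derivative deriv f x) (at x)" "continuous_on UNIV (deriv f)"
  using assms by (auto simp: Ck_def intro: field_differentiable_derivI)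

lemma Ck_tendsto_0_iff:
  "Ck_tendsto 0 fs f \<longleftrightarrow> (\<forall>C. compact C \<longrightarrow> uniform_limit C fs f sequentially)"
  by (simp add: Ck_tendsto_def)

lemma Ck_tendsto_1_iff:
  "Ck_tendsto 1 fs f \<longleftrightarrow> (\<forall>C. compact C \<longrightarrow> uniform_limit C fs f sequentially) \<and>
    (\<forall>C. compact C \<longrightarrow> uniform_limit C (\<lambda>n. deriv (fs n)) (deriv f) sequentially)"
  by (auto simp: Ck_tendsto_def le_Suc_eq)

lemma compact_subset_symmetric_interval:
  fixes C :: "real set"
  assumes "compact C"
  obtains R where "R > 0" "C \<subseteq> {-R..R}"
proof -
  obtain B where B: "B > 0" "\<And>x. x \<in> C \<Longrightarrow> \<bar>x\<bar> \<le> B"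
    using compact_imp_bounded[OF assms] unfolding bounded_pos by auto
  have "x \<in> {-B..B}" if "x \<in> C" for x using B(2)[OF that] by auto
  then have "C \<subseteq> {-B..B}" by blast
  with B(1) show ?thesis by (rule that)
qed

section \<open>Integrals with kernels cut off at the diagonal\<close>

lemma LBINT_01_Icc: "(LBINT y=0..1. f y) = (LBINT y:{0..1}. f y)" for f :: "real \<Rightarrow> real"
  using interval_integral_Icc[of 0 1 f] by (simp add: zero_ereal_def one_ereal_def)

lemma LBINT_0_Icc: "x \<ge> 0 \<Longrightarrow> (LBINT y=0..x. f y) = (LBINT y:{0..x}. f y)" for f :: "real \<Rightarrow> real" and x :: real
  using interval_integral_Icc[of 0 x f] by (simp add: zero_ereal_def)

lemma set_integrable_indicator_mult:
  fixes a :: "real \<Rightarrow> real"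
  assumes "continuous_on UNIV a"
  shows "set_integrable lborel {0..1} (\<lambda>y. indicator {..x} y * a y)"
proof -
  have "set_integrable lborel {0..1} a"
    by (rule borel_integrable_atLeastAtMost'[OF continuous_on_subset[OF assms]]) simp
  then have "integrable lborel (\<lambda>y. indicator {..x} y *\<^sub>R (indicator {0..1} y *\<^sub>R a y))"
    unfolding set_integrable_def by (rule integrable_mult_indicator[rotated]) simp
  then show ?thesis unfolding set_integrable_def by (simp add: mult.left_commute)
qed

text \<open>Multiplied by a continuous function of \<open>y\<close>, both \<open>K\<close> and its
  derivative in \<open>x\<close> have this shape: a Volterra part, cut off at \<open>x\<close>,
  minus a part over the whole interval.\<close>

lemma set_integrable_kernel:
  fixes a b :: "real \<Rightarrow> real"
  assumes "continuous_on UNIV a" "continuous_on UNIV b"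
  shows "set_integrable lborel {0..1} (\<lambda>y. indicator {..x} y * a y - b y)"
  by (intro set_integral_diff(1) set_integrable_indicator_mult assms borel_integrable_atLeastAtMost'
      continuous_on_subset[OF assms(2)]) simp

lemma LBINT_kernel:
  fixes a b :: "real \<Rightarrow> real"
  assumes "continuous_on UNIV a" "continuous_on UNIV b" "x \<in> {0..1}"
  shows "(LBINT y=0..1. indicator {..x} y * a y - b y) = (LBINT y=0..x. a y) - (LBINT y=0..1. b y)"
proof -
  have "(LBINT y:{0..1}. indicator {..x} y * a y) = (LBINT y:{0..x}. a y)"
    unfolding set_lebesgue_integral_def
    by (rule Bochner_Integration.integral_cong) (use assms(3) in \<open>auto simp: indicator_def\<close>)
  then show ?thesis
    using assms(3) set_integral_diff(2)[OF set_integrable_indicator_mult[OF assms(1)]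
        borel_integrable_atLeastAtMost'[OF continuous_on_subset[OF assms(2)]]]
    by (simp add: LBINT_01_Icc LBINT_0_Icc)
qed

lemma LBINT_diff:
  fixes f g :: "real \<Rightarrow> real" and x :: real
  assumes "continuous_on UNIV f" "continuous_on UNIV g"
  shows "(LBINT y=0..x. f y - g y) = (LBINT y=0..x. f y) - (LBINT y=0..x. g y)"
proof -
  have "interval_lebesgue_integrable lborel 0 x h" if "continuous_on UNIV h" for h :: "real \<Rightarrow> real"
    using that unfolding zero_ereal_def
    by (intro interval_integrable_isCont) (auto simp: continuous_on_eq_continuous_at)
  then show ?thesis using assms by (intro interval_lebesgue_integral_diff(2)) auto
qed

lemma continuous_bound_Icc:
  fixes g :: "real \<Rightarrow> real"
  assumes "continuous_on UNIV g"
  obtains C where "\<And>x. x \<in> {a..b} \<Longrightarrow> \<bar>g x\<bar> \<le> C"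
  using bounded_continuous_image[OF assms, of a b] unfolding bounded_iff real_norm_def by blast

section \<open>The divergence form\<close>

locale generator =
  fixes \<sigma> \<beta> S :: "real \<Rightarrow> real"
  assumes \<sigma>_cont: "continuous_on UNIV \<sigma>" and \<beta>_cont: "continuous_on UNIV \<beta>"
    and \<sigma>_pos: "\<And>x. \<sigma> x > 0"
    and \<sigma>_conv: "\<And>\<Phi> n. mollifier \<Phi> \<Longrightarrow> n \<ge> 1 \<Longrightarrow> convolution_exists (\<lambda>x. (\<sigma> x)\<^sup>2) (rescale \<Phi> n)"
    and \<beta>_conv: "\<And>\<Phi> n. mollifier \<Phi> \<Longrightarrow> n \<ge> 1 \<Longrightarrow> convolution_exists \<beta> (rescale \<Phi> n)"
    and Sigma: "is_Sigma \<sigma> \<beta> S"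
begin

lemma S_cont: "continuous_on UNIV S"
  using Sigma by (simp add: is_Sigma_def Ck_def)

lemma \<sigma>2_cont: "continuous_on UNIV (\<lambda>x. (\<sigma> x)\<^sup>2)"
  by (intro continuous_intros \<sigma>_cont)

lemma \<sigma>2_pos: "(\<sigma> x)\<^sup>2 > 0"
  using \<sigma>_pos[of x] by simp

lemma \<sigma>2_lower_bound:
  obtains m where "m > 0" "\<And>x. x \<in> {-R..R} \<Longrightarrow> m \<le> (\<sigma> x)\<^sup>2"
proof (cases "R \<ge> 0")
  case True
  then have "\<exists>x\<in>{-R..R}. \<forall>y\<in>{-R..R}. (\<sigma> x)\<^sup>2 \<le> (\<sigma> y)\<^sup>2"
    by (intro continuous_attains_inf continuous_on_subset[OF \<sigma>2_cont]) auto
  then show ?thesis using that \<sigma>2_pos by blast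
next
  case False
  then show ?thesis using that[of 1] by auto
qed

lemma sigma2_n_cont:
  assumes "mollifier \<Phi>" "n \<ge> 1"
  shows "continuous_on UNIV (sigma2_n \<sigma> \<Phi> n)"
proof -
  obtain M where "integrable lborel (\<lambda>y. (\<sigma> y)\<^sup>2 / (1 + \<bar>y\<bar>) ^ M)"
    using convolution_exists_imp_tempered[OF \<sigma>2_cont \<sigma>_conv] by auto
  from convolution_rescale_C1(1)[OF \<sigma>2_cont this assms] show ?thesis by (simp add: sigma2_n_def)
qed

lemma sigma2_n_limit:
  assumes "mollifier \<Phi>" "compact C"
  shows "uniform_limit C (sigma2_n \<sigma> \<Phi>) (\<lambda>x. (\<sigma> x)\<^sup>2) sequentially"
proof -
  obtain M where "integrable lborel (\<lambda>y. (\<sigma> y)\<^sup>2 / (1 + \<bar>y\<bar>) ^ M)"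
    using convolution_exists_imp_tempered[OF \<sigma>2_cont \<sigma>_conv] by auto
  from convolution_rescale_uniform_limit[OF \<sigma>2_cont this assms] show ?thesis
    by (simp add: sigma2_n_def[abs_def])
qed

lemma deriv_beta_n_cont:
  assumes "mollifier \<Phi>" "n \<ge> 1"
  shows "continuous_on UNIV (deriv (beta_n \<beta> \<Phi> n))"
proof -
  obtain M where "integrable lborel (\<lambda>y. \<beta> y / (1 + \<bar>y\<bar>) ^ M)"
    using convolution_exists_imp_tempered[OF \<beta>_cont \<beta>_conv] by auto
  from convolution_rescale_C1(3)[OF \<beta>_cont this assms] show ?thesis
    by (simp add: beta_n_def[abs_def])
qed

text \<open>The tolerance \<open>m / 2\<close> is at most \<open>\<sigma>\<^sup>2 / 2\<close> on the
  interval. The threshold is the function \<open>\<sigma>\<^sup>2 / 2\<close> and not a constant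
  tied to \<open>R\<close>, so that one truncation by it works on all compact sets in the converse
  below.\<close>

lemma sigma2_n_eventually_large:
  assumes "mollifier \<Phi>"
  obtains m where "m > 0" "\<And>x. x \<in> {-R..R} \<Longrightarrow> m \<le> (\<sigma> x)\<^sup>2"
    "\<forall>\<^sub>F n in sequentially. \<forall>x\<in>{-R..R}. sigma2_n \<sigma> \<Phi> n x > (\<sigma> x)\<^sup>2 / 2"
proof -
  obtain m where m: "m > 0" "\<And>x. x \<in> {-R..R} \<Longrightarrow> m \<le> (\<sigma> x)\<^sup>2" using \<sigma>2_lower_bound by blast
  have "\<forall>\<^sub>F n in sequentially. \<forall>x\<in>{-R..R}. dist (sigma2_n \<sigma> \<Phi> n x) ((\<sigma> x)\<^sup>2) < m / 2"
    by (rule uniform_limitD[OF sigma2_n_limit[OF assms]]) (use m in auto)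
  then have "\<forall>\<^sub>F n in sequentially. \<forall>x\<in>{-R..R}. sigma2_n \<sigma> \<Phi> n x > (\<sigma> x)\<^sup>2 / 2"
  proof (rule eventually_mono, intro ballI)
    fix n x assume "\<forall>x\<in>{-R..R}. dist (sigma2_n \<sigma> \<Phi> n x) ((\<sigma> x)\<^sup>2) < m / 2" and x: "x \<in> {-R..R}"
    then have "\<bar>sigma2_n \<sigma> \<Phi> n x - (\<sigma> x)\<^sup>2\<bar> < m / 2" by (auto simp: dist_real_def)
    then show "sigma2_n \<sigma> \<Phi> n x > (\<sigma> x)\<^sup>2 / 2" using m(2)[OF x] by linarith
  qed
  with m show ?thesis by (rule that)
qed

lemma Sigma_n_limit:
  assumes "mollifier \<Phi>"
  shows "uniform_limit {-R..R} (Sigma_n \<sigma> \<beta> \<Phi>) S sequentially"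
  using Sigma assms unfolding is_Sigma_def Ck_tendsto_0_iff by auto

text \<open>At level \<open>n\<close> the factor \<open>exp \<Sigma>\<^sub>n\<close> is a classical
  integrating factor, as \<open>\<Sigma>\<^sub>n' = 2 \<beta>\<^sub>n' /
  \<sigma>\<^sub>n\<^sup>2\<close> wherever the denominator is positive nearby. It leaves an
  identity all of whose terms converge; a single mollifier is enough here.\<close>

lemma C1_solution_DERIV:
  assumes "C1_solution \<sigma> \<beta> l f"
  shows "((\<lambda>x. exp (S x) * deriv f x) has_real_derivative 2 * l x * exp (S x) / (\<sigma> x)\<^sup>2) (at x)"
proof -
  obtain \<Phi> where \<Phi>: "mollifier \<Phi>" using mollifier_exists by blast
  have l: "continuous_on UNIV l" and f: "Ck 1 f" using assms by (auto simp: C1_solution_def Ck_def)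
  obtain fs ls where fs: "\<And>n. n \<ge> 1 \<Longrightarrow> Ck 2 (fs n)" "\<And>n. n \<ge> 1 \<Longrightarrow> Ck 0 (ls n)"
    "\<And>n. n \<ge> 1 \<Longrightarrow> L_n \<sigma> \<beta> \<Phi> n (fs n) = ls n" and lim: "Ck_tendsto 1 fs f" "Ck_tendsto 0 ls l"
    using assms \<Phi> unfolding C1_solution_def by metis
  define s where "s = sigma2_n \<sigma> \<Phi>"
  define T where "T = Sigma_n \<sigma> \<beta> \<Phi>"
  \<comment> \<open>\<open>x\<close> has to be interior to \<open>{-R..R}\<close>, and this interval
    interior to the one on which \<open>\<sigma>\<^sub>n\<^sup>2\<close> is positive, so that
    \<open>T n\<close> is differentiable at all its points; hence \<open>R + 1\<close>
    below.\<close>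
  define R where "R = \<bar>x\<bar> + 1"
  obtain m where m: "m > 0" "\<And>x. x \<in> {-(R+1)..R+1} \<Longrightarrow> m \<le> (\<sigma> x)\<^sup>2"
    "\<forall>\<^sub>F n in sequentially. \<forall>x\<in>{-(R+1)..R+1}. s n x > (\<sigma> x)\<^sup>2 / 2"
    unfolding s_def by (rule sigma2_n_eventually_large[OF \<Phi>, of "R + 1"]) blast
  have mR: "m \<le> (\<sigma> x)\<^sup>2" if "x \<in> {-R..R}" for x using m(2)[of x] that by auto
  show ?thesis
  proof (rule uniform_limit_DERIV[where R = R and F = "\<lambda>n x. exp (T n x) * deriv (fs n) x"
        and F' = "\<lambda>n x. 2 * ls n x * exp (T n x) / s n x"])
    show "\<forall>\<^sub>F n in sequentially. \<forall>x\<in>{-R..R}.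
       ((\<lambda>x. exp (T n x) * deriv (fs n) x) has_real_derivative 2 * ls n x * exp (T n x) / s n x) (at x)"
      using m(3) eventually_ge_at_top[of 1]
    proof eventually_elim
      case (elim n)
      have s_pos: "s n y > 0" if "y \<in> {-(R+1)..R+1}" for y
        using elim(1) that \<sigma>2_pos[of y] by (auto intro: less_trans[of 0 "(\<sigma> y)\<^sup>2 / 2"])
      show ?case
      proof
        fix y assume y: "y \<in> {-R..R}"
        define b where "b = deriv (beta_n \<beta> \<Phi> n)"
        have "continuous_on {-(R+1)..R+1} (\<lambda>y. b y / s n y)"
          unfolding b_def s_def using s_pos s_def
          by (intro continuous_on_divide continuous_on_subset[OF deriv_beta_n_cont] continuous_on_subset[OF sigma2_n_cont] \<Phi> elim)
            (auto simp: less_imp_neq[symmetric])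
        then have "((\<lambda>x. LBINT y=0..x. b y / s n y) has_real_derivative b y / s n y) (at y)"
          by (rule LBINT_DERIV_on) (use y in \<open>auto simp: R_def\<close>)
        then have T: "(T n has_real_derivative 2 * (b y / s n y)) (at y)"
          unfolding T_def Sigma_n_def[abs_def] b_def s_def by (rule DERIV_cmult)
        have D: "(deriv (fs n) has_real_derivative deriv (deriv (fs n)) y) (at y)"
          by (rule Ck_2D[OF fs(1)[OF elim(2)]])
        have spos: "s n y > 0" using s_pos y by auto
        have "s n y / 2 * deriv (deriv (fs n)) y + b y * deriv (fs n) y = ls n y"
          using fun_cong[OF fs(3)[OF elim(2)], of y] by (simp add: L_n_def s_def b_def)
        then have ls: "2 * ls n y / s n y = deriv (deriv (fs n)) y + 2 * (b y / s n y) * deriv (fs n) y"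
          using spos by (simp add: field_simps)
        have "((\<lambda>x. exp (T n x) * deriv (fs n) x) has_real_derivative
            exp (T n y) * (2 * (b y / s n y)) * deriv (fs n) y + deriv (deriv (fs n)) y * exp (T n y)) (at y)"
          by (rule DERIV_mult[OF DERIV_chain'[OF T DERIV_exp] D])
        also have "exp (T n y) * (2 * (b y / s n y)) * deriv (fs n) y + deriv (deriv (fs n)) y * exp (T n y)
            = exp (T n y) * (2 * ls n y / s n y)"
          unfolding ls by (simp add: algebra_simps)
        finally show "((\<lambda>x. exp (T n x) * deriv (fs n) x) has_real_derivative 2 * ls n y * exp (T n y) / s n y) (at y)"
          by (simp add: mult_ac)
      qed
    qed
    have explim: "uniform_limit {-R..R} (\<lambda>n x. exp (T n x)) (\<lambda>x. exp (S x)) sequentially"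
      unfolding T_def by (intro uniform_limit_exp Sigma_n_limit \<Phi> bounded_continuous_image S_cont)
    show "uniform_limit {-R..R} (\<lambda>n x. 2 * ls n x * exp (T n x) / s n x) (\<lambda>x. 2 * l x * exp (S x) / (\<sigma> x)\<^sup>2) sequentially"
    proof (rule uniform_lim_divide[OF _ _ _ _ m(1)])
      show "uniform_limit {-R..R} (\<lambda>n x. 2 * ls n x * exp (T n x)) (\<lambda>x. 2 * l x * exp (S x)) sequentially"
      proof (intro uniform_lim_mult explim uniform_limit_const bounded_continuous_image continuous_intros l S_cont)
        show "uniform_limit {-R..R} ls l sequentially" using lim(2) by (auto simp: Ck_tendsto_0_iff)
      qed
      show "uniform_limit {-R..R} s (\<lambda>x. (\<sigma> x)\<^sup>2) sequentially"
        unfolding s_def by (intro sigma2_n_limit \<Phi>) auto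
      show "bounded ((\<lambda>x. 2 * l x * exp (S x)) ` {-R..R})"
        by (intro bounded_continuous_image continuous_intros l S_cont)
    qed (use mR in auto)
    show "continuous_on UNIV (\<lambda>x. 2 * l x * exp (S x) / (\<sigma> x)\<^sup>2)"
      using \<sigma>_pos by (intro continuous_intros l S_cont \<sigma>_cont) (auto simp: less_imp_neq[symmetric])
    show "(\<lambda>n. exp (T n y) * deriv (fs n) y) \<longlonglongrightarrow> exp (S y) * deriv f y" if "y \<in> {-R..R}" for y
    proof (rule tendsto_mult)
      show "(\<lambda>n. exp (T n y)) \<longlonglongrightarrow> exp (S y)" by (rule tendsto_uniform_limitI[OF explim that])
      show "(\<lambda>n. deriv (fs n) y) \<longlonglongrightarrow> deriv f y"
        using lim(1)[unfolded Ck_tendsto_1_iff] by (intro tendsto_uniform_limitI[OF _ that]) simp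
    qed
  qed (simp add: R_def)
qed

text \<open>The truncation \<open>max (\<sigma>\<^sub>n\<^sup>2) (\<sigma>\<^sup>2 / 2)\<close> makes the approximating primitive globally defined
  although \<open>\<sigma>\<^sub>n\<^sup>2\<close> may vanish far out; on a given compact set it is eventually inactive.\<close>

lemma C1_solutionI:
  assumes l: "continuous_on UNIV l" and f: "Ck 1 f"
    and D: "\<And>x. ((\<lambda>x. exp (S x) * deriv f x) has_real_derivative 2 * l x * exp (S x) / (\<sigma> x)\<^sup>2) (at x)"
  shows "C1_solution \<sigma> \<beta> l f"
  unfolding C1_solution_def
proof (intro conjI allI impI f)
  show "Ck 0 l" using l by (simp add: Ck_def)
  fix \<Phi> assume \<Phi>: "mollifier \<Phi>"
  define s where "s = sigma2_n \<sigma> \<Phi>"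
  define b where "b = (\<lambda>n. deriv (beta_n \<beta> \<Phi> n))"
  \<comment> \<open>The index 0 is not constrained by \<open>C1_solution\<close>, so it is replaced by 1.\<close>
  define \<tau> where "\<tau> = (\<lambda>n x. max (s (max 1 n) x) ((\<sigma> x)\<^sup>2 / 2))"
  define r where "r = (\<lambda>n x. b (max 1 n) x / \<tau> n x)"
  define T :: "nat \<Rightarrow> real \<Rightarrow> real" where "T = (\<lambda>n x. 2 * (LBINT y=0..x. r n y))"
  define q where "q = (\<lambda>x. exp (S x) * deriv f x)"
  define q' where "q' = (\<lambda>x. 2 * l x * exp (S x) / (\<sigma> x)\<^sup>2)"
  define v where "v = (\<lambda>n x. exp (- T n x) * q x)"
  define w where "w = (\<lambda>n x. exp (- T n x) * (q' x - 2 * r n x * q x))"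
  define fs :: "nat \<Rightarrow> real \<Rightarrow> real" where "fs = (\<lambda>n x. f 0 + (LBINT y=0..x. v n y))"
  have s_cont: "continuous_on UNIV (s (max 1 n))" and b_cont: "continuous_on UNIV (b (max 1 n))" for n
    unfolding s_def b_def by (intro sigma2_n_cont deriv_beta_n_cont \<Phi>; simp)+
  have \<tau>_pos: "\<tau> n x > 0" for n x
    unfolding \<tau>_def using \<sigma>2_pos[of x] by (simp add: less_max_iff_disj)
  have \<tau>_cont: "continuous_on UNIV (\<tau> n)" for n
    unfolding \<tau>_def by (intro continuous_intros s_cont \<sigma>_cont) simp
  have r_cont: "continuous_on UNIV (r n)" for n
    unfolding r_def using \<tau>_pos by (intro continuous_intros b_cont \<tau>_cont) (auto simp: less_imp_neq[symmetric])
  have T_D: "(T n has_real_derivative 2 * r n x) (at x)" for n x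
    unfolding T_def by (intro DERIV_cmult LBINT_DERIV r_cont)
  have T_cont: "continuous_on UNIV (T n)" for n
    by (rule DERIV_continuous_UNIV[OF T_D])
  have q_D: "(q has_real_derivative q' x) (at x)" for x unfolding q_def q'_def by (rule D)
  have q_cont: "continuous_on UNIV q"
    by (rule DERIV_continuous_UNIV[OF q_D])
  have q'_cont: "continuous_on UNIV q'"
    unfolding q'_def using \<sigma>_pos by (intro continuous_intros l S_cont \<sigma>_cont) (auto simp: less_imp_neq[symmetric])
  have v_D: "(v n has_real_derivative w n x) (at x)" for n x
    unfolding v_def w_def
    by (rule derivative_eq_intros T_D q_D refl | simp add: algebra_simps)+
  have v_cont: "continuous_on UNIV (v n)" for n
    by (rule DERIV_continuous_UNIV[OF v_D])
  have w_cont: "continuous_on UNIV (w n)" for n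
    unfolding w_def by (intro continuous_intros T_cont q_cont q'_cont r_cont)
  have fs_D: "(fs n has_real_derivative v n x) (at x)" for n x
    unfolding fs_def using DERIV_add[OF DERIV_const LBINT_DERIV[OF v_cont]] by simp
  note fs = Ck_2I[OF fs_D v_D w_cont]
  have f_D: "(f has_real_derivative deriv f x) (at x)" for x by (rule Ck_1D[OF f])
  have ls: "L_n \<sigma> \<beta> \<Phi> n (fs n) = (\<lambda>x. s n x / 2 * w n x + b n x * v n x)" for n
    by (intro ext) (simp add: L_n_def s_def b_def fs)
  have large: "\<forall>\<^sub>F n in sequentially. \<forall>x\<in>{-R..R}. n \<ge> 1 \<and> s n x > 0 \<and> \<tau> n x = s n x \<and> T n x = Sigma_n \<sigma> \<beta> \<Phi> n x"
    for R
  proof -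
    obtain m where "\<forall>\<^sub>F n in sequentially. \<forall>x\<in>{-R..R}. s n x > (\<sigma> x)\<^sup>2 / 2"
      unfolding s_def by (rule sigma2_n_eventually_large[OF \<Phi>]) blast
    then show ?thesis using eventually_ge_at_top[of 1]
    proof eventually_elim
      case (elim n)
      have n: "max 1 n = n" using elim(2) by simp
      have \<tau>: "\<tau> n x = s n x" if "x \<in> {-R..R}" for x
        using bspec[OF elim(1) that] unfolding \<tau>_def n by (simp add: max_absorb1)
      show ?case
      proof (intro ballI conjI)
        fix x assume x: "x \<in> {-R..R}"
        show "n \<ge> 1" by (rule elim)
        show "\<tau> n x = s n x" by (rule \<tau>[OF x])
        then show "s n x > 0" using \<tau>_pos[of n x] by simp
        show "T n x = Sigma_n \<sigma> \<beta> \<Phi> n x"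
          unfolding T_def Sigma_n_def r_def n b_def
        proof (intro arg_cong[where f = "\<lambda>x. 2 * x"] interval_integral_cong)
          fix y assume "y \<in> einterval (min 0 (ereal x)) (max 0 (ereal x))"
          then have "y \<in> {-R..R}" using x
            by (auto simp: einterval_iff min_def max_def zero_ereal_def split: if_splits)
          then show "deriv (beta_n \<beta> \<Phi> n) y / \<tau> n y = deriv (beta_n \<beta> \<Phi> n) y / sigma2_n \<sigma> \<Phi> n y"
            using \<tau> by (simp add: s_def)
        qed
      qed
    qed
  qed
  have T_lim: "uniform_limit {-R..R} T S sequentially" for R
  proof -
    have "\<forall>\<^sub>F n in sequentially. \<forall>x\<in>{-R..R}. T n x = Sigma_n \<sigma> \<beta> \<Phi> n x"
      using large[of R] by (rule eventually_mono) blast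
    then show ?thesis using Sigma_n_limit[OF \<Phi>] by (subst uniform_limit_cong) auto
  qed
  have exp_lim: "uniform_limit {-R..R} (\<lambda>n x. exp (- T n x)) (\<lambda>x. exp (- S x)) sequentially" for R
    by (intro uniform_limit_exp uniform_limit_uminus T_lim bounded_continuous_image continuous_intros S_cont)
  have v_lim: "uniform_limit {-R..R} v (deriv f) sequentially" for R
  proof -
    have "uniform_limit {-R..R} v (\<lambda>x. exp (- S x) * q x) sequentially"
      unfolding v_def
      by (intro uniform_lim_mult exp_lim uniform_limit_const bounded_continuous_image continuous_intros S_cont q_cont)
    also have "(\<lambda>x. exp (- S x) * q x) = deriv f" by (simp add: q_def fun_eq_iff exp_minus field_simps)
    finally show ?thesis .
  qed
  have fs_lim: "uniform_limit {-R..R} fs f sequentially" for R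
    by (rule uniform_limit_antideriv[OF fs_D f_D _ v_lim]) (simp add: fs_def zero_ereal_def[symmetric])
  have ls_lim: "uniform_limit {-R..R} (\<lambda>n. L_n \<sigma> \<beta> \<Phi> n (fs n)) l sequentially" for R
  proof -
    have "uniform_limit {-R..R} (\<lambda>n x. s n x * (q' x / 2) * exp (- T n x)) (\<lambda>x. (\<sigma> x)\<^sup>2 * (q' x / 2) * exp (- S x)) sequentially"
      unfolding s_def
      by (intro uniform_lim_mult exp_lim sigma2_n_limit \<Phi> uniform_limit_const bounded_continuous_image
          continuous_intros S_cont q'_cont \<sigma>_cont) auto
    also have "(\<lambda>x. (\<sigma> x)\<^sup>2 * (q' x / 2) * exp (- S x)) = l"
      using \<sigma>_pos by (auto simp: q'_def fun_eq_iff exp_minus field_simps less_imp_neq[symmetric])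
    finally have "uniform_limit {-R..R} (\<lambda>n x. s n x * (q' x / 2) * exp (- T n x)) l sequentially" .
    moreover have "\<forall>\<^sub>F n in sequentially. \<forall>x\<in>{-R..R}. L_n \<sigma> \<beta> \<Phi> n (fs n) x = s n x * (q' x / 2) * exp (- T n x)"
      using large[of R]
    proof (rule eventually_mono, intro ballI)
      fix n x assume "\<forall>x\<in>{-R..R}. n \<ge> 1 \<and> s n x > 0 \<and> \<tau> n x = s n x \<and> T n x = Sigma_n \<sigma> \<beta> \<Phi> n x"
        and x: "x \<in> {-R..R}"
      then have n: "max 1 n = n" and s: "s n x > 0" and \<tau>: "\<tau> n x = s n x" by auto
      \<comment> \<open>By this identity the first-order term \<open>b n * v n\<close> cancels
        against the part \<open>- 2 * r n * q\<close> of \<open>w n\<close>. Thus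
        \<open>\<beta>\<^sub>n'\<close> drops out of \<open>L_n\<close> applied to
        \<open>fs n\<close>.\<close>
      have r: "r n x * s n x = b n x" unfolding r_def n \<tau> using s by simp
      show "L_n \<sigma> \<beta> \<Phi> n (fs n) x = s n x * (q' x / 2) * exp (- T n x)"
        unfolding ls w_def v_def r[symmetric] by (simp add: algebra_simps)
    qed
    ultimately show ?thesis by (subst uniform_limit_cong) auto
  qed
  have compacts: "uniform_limit C g h sequentially"
    if "compact C" "\<And>R. uniform_limit {-R..R} g h sequentially" for C and g :: "nat \<Rightarrow> real \<Rightarrow> real" and h
    using compact_subset_symmetric_interval[OF that(1)] that(2) uniform_limit_on_subset by metis
  show "\<exists>fs ls. (\<forall>n\<ge>1. Ck 2 (fs n) \<and> Ck 0 (ls n) \<and> L_n \<sigma> \<beta> \<Phi> n (fs n) = ls n) \<and>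
      Ck_tendsto 1 fs f \<and> Ck_tendsto 0 ls l"
  proof (intro exI conjI allI impI)
    fix n :: nat assume "1 \<le> n"
    then have n: "max 1 n = n" by simp
    show "Ck 2 (fs n)" by (rule fs)
    show "Ck 0 (L_n \<sigma> \<beta> \<Phi> n (fs n))"
      unfolding ls Ck_def using s_cont[of n, unfolded n] b_cont[of n, unfolded n]
      by (auto intro!: continuous_intros w_cont v_cont)
  next
    show "Ck_tendsto 1 fs f"
      unfolding Ck_tendsto_1_iff fs(2) using fs_lim v_lim compacts by metis
    show "Ck_tendsto 0 (\<lambda>n. L_n \<sigma> \<beta> \<Phi> n (fs n)) l"
      unfolding Ck_tendsto_0_iff using ls_lim compacts by metis
  qed auto
qed

section \<open>The boundary value problem\<close>

definition scale :: "real \<Rightarrow> real" where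
  "scale x = (LBINT y=0..x. exp (- S y))"

text \<open>Scale function and speed density in the sense of Feller: since
  \<open>scale' = exp (- S)\<close>, the divergence form reads
  \<open>L f = (f' / scale')' / speed\<close>.\<close>

definition speed :: "real \<Rightarrow> real" where
  "speed y = 2 * exp (S y) / (\<sigma> y)\<^sup>2"

lemma scale_DERIV: "(scale has_real_derivative exp (- S x)) (at x)"
  unfolding scale_def[abs_def] by (intro LBINT_DERIV continuous_intros S_cont)

lemma scale_cont: "continuous_on UNIV scale"
  by (rule DERIV_continuous_UNIV[OF scale_DERIV])

lemma speed_cont: "continuous_on UNIV speed"
  unfolding speed_def[abs_def] using \<sigma>_pos
  by (intro continuous_intros S_cont \<sigma>_cont) (auto simp: less_imp_neq[symmetric])

lemma scale_0 [simp]: "scale 0 = 0"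
  by (simp add: scale_def zero_ereal_def[symmetric])

lemma scale_1_pos: "scale 1 > 0"
  using DERIV_pos_imp_increasing[of 0 1 scale] scale_DERIV exp_gt_zero by (metis scale_0 zero_less_one)

lemma LBINT_exp_S: "(LBINT z=y..x. exp (- S z)) = scale x - scale y"
  by (rule interval_integral_FTC_finite)
    (auto intro!: continuous_intros continuous_on_subset[OF S_cont]
      has_vector_derivative_at_within[OF scale_DERIV[unfolded has_real_derivative_iff_has_vector_derivative]])

definition speed_int :: "(real \<Rightarrow> real) \<Rightarrow> real \<Rightarrow> real" where
  "speed_int g x = (LBINT y=0..x. speed y * g y)"

text \<open>This is the primitive of \<open>exp (- S) * speed_int g\<close>, integrated by parts.\<close>

definition scale_speed_int :: "(real \<Rightarrow> real) \<Rightarrow> real \<Rightarrow> real" where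
  "scale_speed_int g x = scale x * speed_int g x - speed_int (\<lambda>y. g y * scale y) x"

text \<open>Variation of constants: \<open>scale_speed_int g\<close> solves the equation with zero
  value and zero derivative at 0, constants and \<open>scale\<close> solve the homogeneous equation,
  and the coefficient of \<open>scale\<close> is adjusted to the value \<open>B\<close> at
  1.\<close>

definition bvp_sol :: "real \<Rightarrow> real \<Rightarrow> (real \<Rightarrow> real) \<Rightarrow> real \<Rightarrow> real" where
  "bvp_sol A B g x = A + (B - A - scale_speed_int g 1) / scale 1 * scale x + scale_speed_int g x"

definition bvp_sol' :: "real \<Rightarrow> real \<Rightarrow> (real \<Rightarrow> real) \<Rightarrow> real \<Rightarrow> real" where
  "bvp_sol' A B g x = exp (- S x) * ((B - A - scale_speed_int g 1) / scale 1 + speed_int g x)"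

lemma speed_int_0 [simp]: "speed_int g 0 = 0"
  by (simp add: speed_int_def zero_ereal_def[symmetric])

lemma speed_int_DERIV:
  "continuous_on UNIV g \<Longrightarrow> (speed_int g has_real_derivative speed x * g x) (at x)"
  unfolding speed_int_def[abs_def] by (intro LBINT_DERIV continuous_intros speed_cont)

lemma speed_int_cong:
  assumes "\<And>y. y \<in> {0..1} \<Longrightarrow> g y = h y" "x \<in> {0..1}"
  shows "speed_int g x = speed_int h x"
  unfolding speed_int_def
  by (rule interval_integral_cong) (use assms in \<open>auto simp: einterval_iff zero_ereal_def min_def max_def split: if_splits\<close>)

text \<open>A right-hand side on \<open>{0..1}\<close> has many continuous extensions to the line.
  All integrals start at 0 and end at \<open>x\<close> or 1, so they do not see which one was
  chosen.\<close>

lemma bvp_sol_cong: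
  assumes "\<And>y. y \<in> {0..1} \<Longrightarrow> g y = h y" "x \<in> {0..1}"
  shows "bvp_sol A B g x = bvp_sol A B h x" "bvp_sol' A B g x = bvp_sol' A B h x"
proof -
  have P: "speed_int g z = speed_int h z" if "z \<in> {0..1}" for z
    using speed_int_cong[OF assms(1) that] by simp
  have "speed_int (\<lambda>y. g y * scale y) z = speed_int (\<lambda>y. h y * scale y) z" if "z \<in> {0..1}" for z
    by (rule speed_int_cong[OF _ that]) (simp add: assms(1))
  then have Q: "scale_speed_int g z = scale_speed_int h z" if "z \<in> {0..1}" for z
    using P that by (simp add: scale_speed_int_def)
  show "bvp_sol A B g x = bvp_sol A B h x" "bvp_sol' A B g x = bvp_sol' A B h x"
    using P Q assms(2) by (simp_all add: bvp_sol_def bvp_sol'_def)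
qed

lemma bvp_sol_bounds [simp]: "bvp_sol A B g 0 = A" "bvp_sol A B g 1 = B"
  using scale_1_pos by (simp_all add: bvp_sol_def scale_speed_int_def)

lemma bvp_sol_DERIV:
  assumes g: "continuous_on UNIV g"
  shows "(bvp_sol A B g has_real_derivative bvp_sol' A B g x) (at x)"
    and "((\<lambda>x. exp (S x) * bvp_sol' A B g x) has_real_derivative speed x * g x) (at x)"
proof -
  have gs: "continuous_on UNIV (\<lambda>y. g y * scale y)" by (intro continuous_intros g scale_cont)
  note D = speed_int_DERIV[OF g] speed_int_DERIV[OF gs] scale_DERIV
  show "(bvp_sol A B g has_real_derivative bvp_sol' A B g x) (at x)"
    unfolding bvp_sol_def[abs_def] bvp_sol'_def scale_speed_int_def[of g x for x]
    by (rule derivative_eq_intros D refl | simp add: algebra_simps)+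
  have "(\<lambda>x. exp (S x) * bvp_sol' A B g x) = (\<lambda>x. (B - A - scale_speed_int g 1) / scale 1 + speed_int g x)"
    by (simp add: bvp_sol'_def fun_eq_iff exp_minus)
  then show "((\<lambda>x. exp (S x) * bvp_sol' A B g x) has_real_derivative speed x * g x) (at x)"
    using DERIV_add[OF DERIV_const D(1)] by simp
qed

lemma bvp_sol'_cont:
  assumes "continuous_on UNIV g"
  shows "continuous_on UNIV (bvp_sol' A B g)"
proof -
  have "continuous_on UNIV (speed_int g)"
    by (rule DERIV_continuous_UNIV[where f' = "\<lambda>x. speed x * g x"]) (rule speed_int_DERIV[OF assms])
  then show ?thesis unfolding bvp_sol'_def[abs_def] by (intro continuous_intros S_cont)
qed

lemma bvp_sol_C1_solution:
  assumes "continuous_on UNIV g"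
  shows "Ck 1 (bvp_sol A B g)" "deriv (bvp_sol A B g) = bvp_sol' A B g" "C1_solution \<sigma> \<beta> g (bvp_sol A B g)"
proof -
  have D: "(bvp_sol A B g has_real_derivative bvp_sol' A B g x) (at x)" for x
    by (rule bvp_sol_DERIV(1)[OF assms])
  show C: "Ck 1 (bvp_sol A B g)" "deriv (bvp_sol A B g) = bvp_sol' A B g"
    by (rule Ck_1I[of "bvp_sol A B g" "bvp_sol' A B g", OF D bvp_sol'_cont[OF assms]])+
  show "C1_solution \<sigma> \<beta> g (bvp_sol A B g)"
    by (rule C1_solutionI[OF assms C(1)])
      (use bvp_sol_DERIV(2)[OF assms] in \<open>simp add: C(2) speed_def mult_ac\<close>)
qed

text \<open>For the difference \<open>d\<close> of two solutions the flux \<open>exp S * d'\<close>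
  is constant, so \<open>d\<close> is affine in \<open>scale\<close>. It vanishes at 0 and 1, where
  \<open>scale\<close> takes different values, hence on the whole line.\<close>

lemma C1_solution_unique:
  assumes "C1_solution \<sigma> \<beta> g u" "u 0 = A" "u 1 = B"
  shows "u = bvp_sol A B g"
proof -
  have g: "continuous_on UNIV g" and u: "Ck 1 u" using assms(1) by (auto simp: C1_solution_def Ck_def)
  define d where "d = (\<lambda>x. u x - bvp_sol A B g x)"
  define d' where "d' = (\<lambda>x. deriv u x - bvp_sol' A B g x)"
  have d: "(d has_real_derivative d' x) (at x)" for x
    unfolding d_def d'_def by (rule DERIV_diff[OF Ck_1D(1)[OF u] bvp_sol_DERIV(1)[OF g, of A B]])
  have "((\<lambda>x. exp (S x) * deriv u x - exp (S x) * bvp_sol' A B g x) has_real_derivative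
      2 * g x * exp (S x) / (\<sigma> x)\<^sup>2 - speed x * g x) (at x)" for x
    by (rule DERIV_diff[OF C1_solution_DERIV[OF assms(1)] bvp_sol_DERIV(2)[OF g, of A B]])
  then have "((\<lambda>x. exp (S x) * d' x) has_real_derivative 0) (at x)" for x
    by (simp add: d'_def right_diff_distrib speed_def mult_ac)
  then obtain c where c: "\<And>x. exp (S x) * d' x = c"
    using DERIV_isconst_all by blast
  then have d'_eq: "d' x = c * exp (- S x)" for x by (metis exp_minus_inverse mult.commute mult.left_commute mult_1_right)
  have "((\<lambda>x. d x - c * scale x) has_real_derivative 0) (at x)" for x
    using DERIV_diff[OF d[of x] DERIV_cmult[OF scale_DERIV[of x], of c]] by (simp add: d'_eq)
  then obtain e where e: "\<And>x. d x - c * scale x = e"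
    using DERIV_isconst_all by blast
  have "d 0 = 0" "d 1 = 0" using assms by (simp_all add: d_def)
  then have "e = 0" "c = 0" using e[of 0] e[of 1] scale_1_pos by auto
  then show ?thesis using e by (auto simp: d_def)
qed

section \<open>The Green kernel\<close>

lemma K_eq:
  "K \<sigma> S x y = indicator {..x} y * (speed y * (scale x - scale y)) - scale x / scale 1 * (speed y * (scale 1 - scale y))"
  unfolding K_def one_ereal_def LBINT_exp_S by (simp add: speed_def scale_def[symmetric] mult_ac)

text \<open>While \<open>t\<close> stays on the same side of \<open>y\<close> as \<open>x\<close>,
  the indicator is constant and \<open>K\<close> is affine in \<open>scale t\<close>. This holds on
  an open set around \<open>x\<close> even if \<open>x\<close> is an endpoint, and the derivative
  within \<open>{0..1}\<close> follows.\<close>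

lemma dK_eq:
  assumes "x \<in> {0..1}" "y \<noteq> x"
  shows "dK \<sigma> S x y = indicator {..x} y * (exp (- S x) * speed y)
    - exp (- S x) / scale 1 * (speed y * (scale 1 - scale y))"
proof -
  let ?G = "\<lambda>t. indicator {..x} y * (speed y * (scale t - scale y)) - scale t / scale 1 * (speed y * (scale 1 - scale y))"
  let ?D = "indicator {..x} y * (exp (- S x) * speed y) - exp (- S x) / scale 1 * (speed y * (scale 1 - scale y))"
  have D: "(?G has_real_derivative ?D) (at x)"
    using DERIV_diff[OF DERIV_cmult[OF DERIV_cmult[OF DERIV_diff[OF scale_DERIV DERIV_const]]]
        DERIV_cmult_right[OF DERIV_cdivide[OF scale_DERIV]], of "indicator {..x} y" "speed y" "scale y" "scale 1" "speed y * (scale 1 - scale y)" x]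
    by (simp add: mult_ac)
  have "((\<lambda>t. K \<sigma> S t y) has_real_derivative ?D) (at x)"
  proof (rule has_field_derivative_transform_within_open[OF D, where S = "if y < x then {y<..} else {..<y}"])
    fix t assume "t \<in> (if y < x then {y<..} else {..<y})"
    then show "?G t = K \<sigma> S t y" using assms(2) by (auto simp: K_eq indicator_def split: if_splits)
  qed (use assms(2) in auto)
  then have "((\<lambda>t. K \<sigma> S t y) has_vector_derivative ?D) (at x within {0..1})"
    by (simp add: has_real_derivative_iff_has_vector_derivative has_vector_derivative_at_within)
  then show ?thesis unfolding dK_def using assms(1)
    by (intro vector_derivative_within_closed_interval) auto
qed

text \<open>The formula for \<open>dK\<close> may fail at \<open>y = x\<close> alone, a null set.
  \<open>\<Psi>\<close> is general in order to cover both the representation of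
  \<open>bvp_sol'\<close> and the integral of absolute values.\<close>

lemma LBINT_dK_cong:
  fixes \<Psi> :: "real \<Rightarrow> real \<Rightarrow> real"
  assumes "x \<in> {0..1}"
  shows "(LBINT y=0..1. \<Psi> y (dK \<sigma> S x y)) = (LBINT y=0..1. \<Psi> y (indicator {..x} y * (exp (- S x) * speed y)
    - exp (- S x) / scale 1 * (speed y * (scale 1 - scale y))))"
  by (rule interval_integral_discrete_difference[where X = "{x}"]) (auto simp: dK_eq[OF assms])

text \<open>\<open>A\<close> and \<open>B\<close> cancel, and what remains is the solution with zero
  boundary values and right-hand side \<open>g - h\<close>: the Volterra integral up to
  \<open>x\<close> minus \<open>scale x / scale 1\<close> times the one up to 1. This is the
  integral against \<open>K\<close>.\<close>

lemma bvp_sol_diff: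
  assumes g: "continuous_on UNIV g" and h: "continuous_on UNIV h" and x: "x \<in> {0..1}"
  shows "bvp_sol A B g x - bvp_sol A B h x = (LBINT y=0..1. K \<sigma> S x y * (g y - h y))"
    and "bvp_sol' A B g x - bvp_sol' A B h x = (LBINT y=0..1. dK \<sigma> S x y * (g y - h y))"
proof -
  define d where "d = (\<lambda>y. g y - h y)"
  have d: "continuous_on UNIV d" unfolding d_def by (intro continuous_intros g h)
  note c = speed_cont scale_cont d
  have P: "speed_int g z - speed_int h z = speed_int d z" for z
    unfolding speed_int_def d_def right_diff_distrib
    by (rule LBINT_diff[symmetric]) (intro continuous_intros speed_cont g h)+
  have "speed_int (\<lambda>y. g y * scale y) z - speed_int (\<lambda>y. h y * scale y) z = speed_int (\<lambda>y. d y * scale y) z" for z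
    unfolding speed_int_def d_def left_diff_distrib right_diff_distrib
    by (rule LBINT_diff[symmetric]) (intro continuous_intros speed_cont scale_cont g h)+
  with P have Q: "scale_speed_int g z - scale_speed_int h z = scale_speed_int d z" for z
    unfolding scale_speed_int_def by (simp add: algebra_simps flip: P)
  have Q_alt: "(LBINT y=0..z. speed y * (scale z - scale y) * d y) = scale_speed_int d z" for z :: real
  proof -
    have "(LBINT y=0..z. speed y * (scale z - scale y) * d y) =
      (LBINT y=0..z. scale z * (speed y * d y) - speed y * (d y * scale y))"
      by (simp add: algebra_simps)
    also have "\<dots> = scale_speed_int d z"
      unfolding scale_speed_int_def speed_int_def
      by (subst LBINT_diff) (auto intro!: continuous_intros c)
    finally show ?thesis .
  qed
  have one: "(LBINT y=0..1. f y) = (LBINT y=0..ereal 1. f y)" for f :: "real \<Rightarrow> real"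
    by (simp add: one_ereal_def)
  have "bvp_sol A B g x - bvp_sol A B h x = scale_speed_int d x - scale x / scale 1 * scale_speed_int d 1"
    unfolding bvp_sol_def Q[symmetric] using scale_1_pos by (simp add: field_simps)
  also have "\<dots> = (LBINT y=0..x. speed y * (scale x - scale y) * d y)
      - (LBINT y=0..1. scale x / scale 1 * (speed y * (scale 1 - scale y) * d y))"
    unfolding one interval_lebesgue_integral_mult_right Q_alt ..
  also have "\<dots> = (LBINT y=0..1. indicator {..x} y * (speed y * (scale x - scale y) * d y)
      - scale x / scale 1 * (speed y * (scale 1 - scale y) * d y))"
    by (rule LBINT_kernel[symmetric, OF _ _ x]) (intro continuous_intros c)+
  also have "\<dots> = (LBINT y=0..1. K \<sigma> S x y * (g y - h y))"
    by (simp add: K_eq d_def left_diff_distrib mult.assoc)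
  finally show "bvp_sol A B g x - bvp_sol A B h x = (LBINT y=0..1. K \<sigma> S x y * (g y - h y))" .
  have "bvp_sol' A B g x - bvp_sol' A B h x =
      exp (- S x) * speed_int d x - exp (- S x) / scale 1 * scale_speed_int d 1"
    unfolding bvp_sol'_def Q[symmetric] P[symmetric] using scale_1_pos by (simp add: field_simps)
  also have "\<dots> = (LBINT y=0..x. exp (- S x) * (speed y * d y))
      - (LBINT y=0..1. exp (- S x) / scale 1 * (speed y * (scale 1 - scale y) * d y))"
    unfolding one interval_lebesgue_integral_mult_right Q_alt speed_int_def ..
  also have "\<dots> = (LBINT y=0..1. indicator {..x} y * (exp (- S x) * (speed y * d y))
      - exp (- S x) / scale 1 * (speed y * (scale 1 - scale y) * d y))"
    by (rule LBINT_kernel[symmetric, OF _ _ x]) (intro continuous_intros c)+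
  also have "\<dots> = (LBINT y=0..1. dK \<sigma> S x y * (g y - h y))"
    unfolding LBINT_dK_cong[OF x, of "\<lambda>y t. t * (g y - h y)"]
    by (simp add: d_def left_diff_distrib mult.assoc)
  finally show "bvp_sol' A B g x - bvp_sol' A B h x = (LBINT y=0..1. dK \<sigma> S x y * (g y - h y))" .
qed

definition kernel_norm :: "real \<Rightarrow> real" where
  "kernel_norm x = (LBINT y=0..1. \<bar>K \<sigma> S x y\<bar> + \<bar>dK \<sigma> S x y\<bar>)"

text \<open>A supremum of reals bounds its members only if the set is bounded above; hence the first
  claim. The second adds values and derivatives because the Lipschitz condition on \<open>F\<close>
  does.\<close>

lemma kernel_norm_bound:
  shows "bdd_above (kernel_norm ` {0..1})"
    and "\<lbrakk>continuous_on UNIV g; continuous_on UNIV h; \<And>y. y \<in> {0..1} \<Longrightarrow> \<bar>g y - h y\<bar> \<le> D; x \<in> {0..1}\<rbrakk> \<Longrightarrow>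
      \<bar>bvp_sol A B g x - bvp_sol A B h x\<bar> + \<bar>bvp_sol' A B g x - bvp_sol' A B h x\<bar> \<le> kernel_norm x * D"
proof -
  define k0 where "k0 = (\<lambda>x y. indicator {..x} y * (speed y * (scale x - scale y)) - scale x / scale 1 * (speed y * (scale 1 - scale y)))"
  define k1 where "k1 = (\<lambda>x y. indicator {..x} y * (exp (- S x) * speed y) - exp (- S x) / scale 1 * (speed y * (scale 1 - scale y)))"
  have K: "K \<sigma> S x y = k0 x y" for x y by (simp add: K_eq k0_def)
  have norm_eq: "kernel_norm x = (LBINT y:{0..1}. \<bar>k0 x y\<bar> + \<bar>k1 x y\<bar>)" if "x \<in> {0..1}" for x
    unfolding kernel_norm_def LBINT_dK_cong[OF that, of "\<lambda>y t. \<bar>K \<sigma> S x y\<bar> + \<bar>t\<bar>"]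
    by (simp only: K k1_def LBINT_01_Icc)
  have int: "set_integrable lborel {0..1} (\<lambda>y. k0 x y * d y)" "set_integrable lborel {0..1} (\<lambda>y. k1 x y * d y)"
    if "continuous_on UNIV d" for x d
  proof -
    have "set_integrable lborel {0..1} (\<lambda>y. indicator {..x} y * (speed y * (scale x - scale y) * d y)
        - scale x / scale 1 * (speed y * (scale 1 - scale y) * d y))"
      by (intro set_integrable_kernel continuous_intros speed_cont scale_cont that)
    then show "set_integrable lborel {0..1} (\<lambda>y. k0 x y * d y)"
      by (simp add: k0_def left_diff_distrib mult.assoc)
    have "set_integrable lborel {0..1} (\<lambda>y. indicator {..x} y * (exp (- S x) * speed y * d y)
        - exp (- S x) / scale 1 * (speed y * (scale 1 - scale y) * d y))"
      by (intro set_integrable_kernel continuous_intros speed_cont scale_cont that)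
    then show "set_integrable lborel {0..1} (\<lambda>y. k1 x y * d y)"
      by (simp add: k1_def left_diff_distrib mult.assoc)
  qed
  have int_norm: "set_integrable lborel {0..1} (\<lambda>y. \<bar>k0 x y\<bar> + \<bar>k1 x y\<bar>)" for x
    using int[of "\<lambda>_. 1" x] by (intro set_integral_add(1) set_integrable_abs) auto
  obtain p where p: "\<And>y. y \<in> {0..1} \<Longrightarrow> \<bar>speed y\<bar> \<le> p"
    using continuous_bound_Icc[OF speed_cont] by blast
  obtain q where q: "\<And>y. y \<in> {0..1} \<Longrightarrow> \<bar>scale y\<bar> \<le> q"
    using continuous_bound_Icc[OF scale_cont] by blast
  have "continuous_on UNIV (\<lambda>x. exp (- S x))" by (intro continuous_intros S_cont)
  then obtain r where r: "\<And>y. y \<in> {0..1} \<Longrightarrow> \<bar>exp (- S y)\<bar> \<le> r"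
    using continuous_bound_Icc by blast
  have nonneg: "p \<ge> 0" "q \<ge> 0" "r \<ge> 0" 
    by (rule order_trans[OF abs_ge_zero p[of 0]] order_trans[OF abs_ge_zero q[of 0]] order_trans[OF abs_ge_zero r[of 0]], simp)+
  \<comment> \<open>The four summands bound in turn the two terms of \<open>k0\<close> and the two
    terms of \<open>k1\<close>; \<open>2 * q\<close> bounds the differences of
    \<open>scale\<close>.\<close>
  define M where "M = (p * (2 * q) + q / scale 1 * (p * (2 * q))) + (r * p + r / scale 1 * (p * (2 * q)))"
  have bound: "\<bar>k0 x y\<bar> + \<bar>k1 x y\<bar> \<le> M" if "x \<in> {0..1}" "y \<in> {0..1}" for x y
  proof -
    have s: "\<bar>scale u - scale v\<bar> \<le> 2 * q" if "u \<in> {0..1}" "v \<in> {0..1}" for u v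
      using q[OF that(1)] q[OF that(2)] by linarith
    have i: "\<bar>indicator {..x} y * t\<bar> \<le> \<bar>t\<bar>" for t :: real by (simp add: indicator_def)
    have a: "\<bar>speed y * (scale u - scale y)\<bar> \<le> p * (2 * q)" if "u \<in> {0..1}" for u
      unfolding abs_mult using that \<open>y \<in> {0..1}\<close> nonneg by (intro mult_mono p s) auto
    have b: "\<bar>exp (- S x) * speed y\<bar> \<le> r * p"
      unfolding abs_mult using that nonneg by (intro mult_mono p r) auto
    have c: "\<bar>scale x / scale 1 * (speed y * (scale 1 - scale y))\<bar> \<le> q / scale 1 * (p * (2 * q))"
      unfolding abs_mult[of "scale x / scale 1"] abs_divide using that nonneg scale_1_pos
      by (intro mult_mono a divide_mono q) auto
    have e: "\<bar>exp (- S x) / scale 1 * (speed y * (scale 1 - scale y))\<bar> \<le> r / scale 1 * (p * (2 * q))"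
      unfolding abs_mult[of "exp (- S x) / scale 1"] abs_divide using that nonneg scale_1_pos
      by (intro mult_mono a divide_mono r) auto
    have "\<bar>k0 x y\<bar> \<le> p * (2 * q) + q / scale 1 * (p * (2 * q))"
      unfolding k0_def using a[OF that(1)] c i[of "speed y * (scale x - scale y)"] by linarith
    moreover have "\<bar>k1 x y\<bar> \<le> r * p + r / scale 1 * (p * (2 * q))"
      unfolding k1_def using b e i[of "exp (- S x) * speed y"] by linarith
    ultimately show ?thesis by (simp add: M_def)
  qed
  have const: "set_integrable lborel {0..1::real} (\<lambda>_. M)" "(LBINT y:{0..1::real}. M) = M"
    using borel_integrable_atLeastAtMost'[OF continuous_on_const] by (auto simp: set_integral_const)
  have "kernel_norm x \<le> M" if "x \<in> {0..1}" for x
    unfolding norm_eq[OF that] using set_integral_mono[OF int_norm const(1) bound[OF that]] const(2) by simp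
  then show "bdd_above (kernel_norm ` {0..1})" by (intro bdd_aboveI2)
  assume g: "continuous_on UNIV g" and h: "continuous_on UNIV h"
    and D: "\<And>y. y \<in> {0..1} \<Longrightarrow> \<bar>g y - h y\<bar> \<le> D" and x: "x \<in> {0..1}"
  have d: "continuous_on UNIV (\<lambda>y. g y - h y)" by (intro continuous_intros g h)
  have abs_le: "\<bar>LBINT y:{0..1}. f y\<bar> \<le> (LBINT y:{0..1}. \<bar>f y\<bar>)" if "set_integrable lborel {0..1} f" for f :: "real \<Rightarrow> real"
    using set_integral_norm_bound[OF that] by simp
  have "\<bar>bvp_sol A B g x - bvp_sol A B h x\<bar> + \<bar>bvp_sol' A B g x - bvp_sol' A B h x\<bar> =
      \<bar>LBINT y:{0..1}. k0 x y * (g y - h y)\<bar> + \<bar>LBINT y:{0..1}. k1 x y * (g y - h y)\<bar>"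
    unfolding bvp_sol_diff[OF g h x] LBINT_dK_cong[OF x, of "\<lambda>y t. t * (g y - h y)"]
    by (simp only: K k1_def LBINT_01_Icc)
  also have "\<dots> \<le> (LBINT y:{0..1}. \<bar>k0 x y * (g y - h y)\<bar>) + (LBINT y:{0..1}. \<bar>k1 x y * (g y - h y)\<bar>)"
    by (intro add_mono abs_le int d)
  also have "\<dots> = (LBINT y:{0..1}. \<bar>k0 x y * (g y - h y)\<bar> + \<bar>k1 x y * (g y - h y)\<bar>)"
    by (rule set_integral_add(2)[symmetric]) (intro set_integrable_abs int d)+
  also have "\<dots> \<le> (LBINT y:{0..1}. (\<bar>k0 x y\<bar> + \<bar>k1 x y\<bar>) * D)"
  proof (rule set_integral_mono)
    show "set_integrable lborel {0..1} (\<lambda>y. \<bar>k0 x y * (g y - h y)\<bar> + \<bar>k1 x y * (g y - h y)\<bar>)"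
      by (intro set_integral_add(1) set_integrable_abs int d)
    show "set_integrable lborel {0..1} (\<lambda>y. (\<bar>k0 x y\<bar> + \<bar>k1 x y\<bar>) * D)"
      by (intro set_integrable_mult_left int_norm)
    fix y :: real assume y: "y \<in> {0..1}"
    show "\<bar>k0 x y * (g y - h y)\<bar> + \<bar>k1 x y * (g y - h y)\<bar> \<le> (\<bar>k0 x y\<bar> + \<bar>k1 x y\<bar>) * D"
      unfolding abs_mult distrib_right[symmetric] by (intro mult_left_mono D y) auto
  qed
  also have "\<dots> = kernel_norm x * D" unfolding norm_eq[OF x] by (rule set_integral_mult_left)
  finally show "\<bar>bvp_sol A B g x - bvp_sol A B h x\<bar> + \<bar>bvp_sol' A B g x - bvp_sol' A B h x\<bar> \<le> kernel_norm x * D" .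
qed

text \<open>The unknown \<open>u\<close> is traded for the right-hand side \<open>g\<close>.
  Uniqueness for the linear problem identifies the extension of \<open>u\<close> with
  \<open>bvp_sol A B g\<close>, and the derivative within \<open>{0..1}\<close>, which sees only
  values on the interval, is then \<open>bvp_sol' A B g\<close>.\<close>

lemma bvp_solution_iff:
  "bvp_solution \<sigma> \<beta> 0 1 A B F u \<longleftrightarrow>
    (\<exists>g. continuous_on UNIV g \<and> (\<forall>x\<in>{0..1}. u x = bvp_sol A B g x \<and> g x = F x (bvp_sol A B g x) (bvp_sol' A B g x)))"
proof -
  have vd: "(u has_vector_derivative bvp_sol' A B g x) (at x within {0..1})"
    if "continuous_on UNIV g" "\<And>x. x \<in> {0..1} \<Longrightarrow> u x = bvp_sol A B g x" "x \<in> {0..1}" for g x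
  proof (rule has_vector_derivative_transform[OF that(3)])
    show "(bvp_sol A B g has_vector_derivative bvp_sol' A B g x) (at x within {0..1})"
      using bvp_sol_DERIV(1)[OF that(1)]
      by (simp add: has_real_derivative_iff_has_vector_derivative has_vector_derivative_at_within)
  qed (rule that(2))
  have vd_eq: "vector_derivative u (at x within {0..1}) = bvp_sol' A B g x"
    if "continuous_on UNIV g" "\<And>x. x \<in> {0..1} \<Longrightarrow> u x = bvp_sol A B g x" "x \<in> {0..1}" for g x
    by (rule vector_derivative_within_closed_interval[OF zero_less_one that(3) vd[OF that]])
  show ?thesis
  proof
    assume "bvp_solution \<sigma> \<beta> 0 1 A B F u"
    then obtain g v where g: "Ck 0 g" "\<And>x. x \<in> {0..1} \<Longrightarrow> g x = F x (u x) (vector_derivative u (at x within {0..1}))"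
      and v: "\<And>x. x \<in> {0..1} \<Longrightarrow> v x = u x" "C1_solution \<sigma> \<beta> g v" "v 0 = A" "v 1 = B"
      unfolding bvp_solution_def linear_bvp_solution_def by blast
    have c: "continuous_on UNIV g" using g(1) by (simp add: Ck_def)
    have u: "u x = bvp_sol A B g x" if "x \<in> {0..1}" for x
      using v(1)[OF that] C1_solution_unique[OF v(2-4)] by simp
    have "g x = F x (bvp_sol A B g x) (bvp_sol' A B g x)" if "x \<in> {0..1}" for x
      using g(2)[OF that] u[OF that] vd_eq[OF c u that] by simp
    with c u show "\<exists>g. continuous_on UNIV g \<and> (\<forall>x\<in>{0..1}. u x = bvp_sol A B g x \<and> g x = F x (bvp_sol A B g x) (bvp_sol' A B g x))"
      by blast
  next
    assume "\<exists>g. continuous_on UNIV g \<and> (\<forall>x\<in>{0..1}. u x = bvp_sol A B g x \<and> g x = F x (bvp_sol A B g x) (bvp_sol' A B g x))"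
    then obtain g where c: "continuous_on UNIV g" and u: "\<And>x. x \<in> {0..1} \<Longrightarrow> u x = bvp_sol A B g x"
      and g: "\<And>x. x \<in> {0..1} \<Longrightarrow> g x = F x (bvp_sol A B g x) (bvp_sol' A B g x)" by blast
    note sol = bvp_sol_C1_solution[OF c, of A B]
    have "continuous_on {0..1} (\<lambda>x. vector_derivative u (at x within {0..1})) \<longleftrightarrow> continuous_on {0..1} (bvp_sol' A B g)"
      by (rule continuous_on_cong[OF refl vd_eq[OF c u]])
    then have "C1_interval 0 1 u"
      unfolding C1_interval_def
      using differentiableI_vector[OF vd[OF c u]] continuous_on_subset[OF bvp_sol'_cont[OF c] subset_UNIV] by blast
    moreover have "linear_bvp_solution \<sigma> \<beta> 0 1 A B (\<lambda>x. F x (u x) (vector_derivative u (at x within {0..1}))) u"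
      unfolding linear_bvp_solution_def
    proof (rule exI[of _ g], rule exI[of _ "bvp_sol A B g"], intro conjI ballI)
      show "Ck 0 g" using c by (simp add: Ck_def)
      show "g x = F x (u x) (vector_derivative u (at x within {0..1}))" if "x \<in> {0..1}" for x
        using g[OF that] u[OF that] vd_eq[OF c u that] by simp
    qed (use sol u in auto)
    ultimately show "bvp_solution \<sigma> \<beta> 0 1 A B F u" by (simp add: bvp_solution_def)
  qed
qed

text \<open>Banach's fixed point theorem is applied to the right-hand side \<open>g = F(x, u, u')\<close> rather than
  to \<open>u\<close>: the space is then \<open>C([0, 1])\<close>, realised by precomposition with the retraction onto
  \<open>[0, 1]\<close>.\<close>

lemma rhs_fixpoint:
  assumes F: "continuous_on ({0..1} \<times> UNIV \<times> UNIV) (\<lambda>(x, y, z). F x y z)"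
    and lip: "\<And>x y y' z z'. x \<in> {0..1} \<Longrightarrow> \<bar>F x y z - F x y' z'\<bar> \<le> k * (\<bar>y - y'\<bar> + \<bar>z - z'\<bar>)"
    and k: "k < inverse (SUP x\<in>{0..1}. kernel_norm x)"
  shows "\<exists>!G :: real \<Rightarrow>\<^sub>C real. \<forall>x. let t = max 0 (min 1 x) in G x = F t (bvp_sol A B G t) (bvp_sol' A B G t)"
proof -
  define cl :: "real \<Rightarrow> real" where "cl = (\<lambda>x. max 0 (min 1 x))"
  have cl: "cl x \<in> {0..1}" for x by (simp add: cl_def)
  have cl_cont: "continuous_on UNIV cl" unfolding cl_def by (intro continuous_intros)
  define C where "C = (SUP x\<in>{0..1}. kernel_norm x)"
  have k0: "k \<ge> 0" using lip[of 0 1 0 0 0] by simp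
  \<comment> \<open>Together with \<open>k \<ge> 0\<close> the strict inequality forces
    \<open>C > 0\<close>, so the convention \<open>inverse 0 = 0\<close> does not interfere and the
    hypothesis means \<open>k * C < 1\<close>.\<close>
  have "inverse C > 0" using k k0 unfolding C_def by linarith
  then have C: "C > 0" by simp
  have kC: "0 \<le> k * C" "k * C < 1"
    using k k0 C unfolding C_def[symmetric] by (auto simp: field_simps)
  define \<Theta> where "\<Theta> = (\<lambda>G x. F (cl x) (bvp_sol A B G (cl x)) (bvp_sol' A B G (cl x)))"
  have \<Theta>: "\<Theta> G \<in> bcontfun" if G: "continuous_on UNIV G" for G
  proof -
    have "continuous_on UNIV (bvp_sol A B G)" "continuous_on UNIV (bvp_sol' A B G)"
      using DERIV_continuous_UNIV[OF bvp_sol_DERIV(1)[OF G]] bvp_sol'_cont[OF G] by auto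
    then have "continuous_on {0..1} (\<lambda>x. (x, bvp_sol A B G x, bvp_sol' A B G x))"
      by (intro continuous_on_Pair continuous_on_id) (auto intro: continuous_on_subset)
    then have c: "continuous_on {0..1} (\<lambda>x. F x (bvp_sol A B G x) (bvp_sol' A B G x))"
      using continuous_on_compose2[OF F] by fastforce
    then have "continuous_on UNIV (\<Theta> G)"
      unfolding \<Theta>_def using cl by (intro continuous_on_compose2[OF c cl_cont]) auto
    moreover have "bounded (range (\<Theta> G))"
    proof (rule bounded_subset)
      show "bounded ((\<lambda>x. F x (bvp_sol A B G x) (bvp_sol' A B G x)) ` {0..1})"
        by (intro compact_imp_bounded compact_continuous_image c) simp
      show "range (\<Theta> G) \<subseteq> (\<lambda>x. F x (bvp_sol A B G x) (bvp_sol' A B G x)) ` {0..1}"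
        unfolding \<Theta>_def using cl by blast
    qed
    ultimately show ?thesis by (simp add: bcontfun_def)
  qed
  define \<Psi> :: "(real \<Rightarrow>\<^sub>C real) \<Rightarrow> (real \<Rightarrow>\<^sub>C real)" where "\<Psi> = (\<lambda>G. Bcontfun (\<Theta> G))"
  have \<Psi>: "apply_bcontfun (\<Psi> G) = \<Theta> G" for G
    unfolding \<Psi>_def by (rule Bcontfun_inverse) (rule \<Theta>, simp)
  have contr: "dist (\<Psi> G) (\<Psi> H) \<le> k * C * dist G H" for G H
  proof (rule dist_bound)
    fix x
    have "dist (\<Psi> G x) (\<Psi> H x) \<le> k * (\<bar>bvp_sol A B G (cl x) - bvp_sol A B H (cl x)\<bar> +
        \<bar>bvp_sol' A B G (cl x) - bvp_sol' A B H (cl x)\<bar>)"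
      unfolding \<Psi> \<Theta>_def dist_real_def by (rule lip[OF cl])
    also have "\<dots> \<le> k * (kernel_norm (cl x) * dist G H)"
      using dist_bounded[of G _ H]
      by (intro mult_left_mono kernel_norm_bound(2) cl k0) (auto simp: dist_real_def)
    also have "\<dots> \<le> k * (C * dist G H)"
      unfolding C_def by (intro mult_left_mono mult_right_mono cSUP_upper cl kernel_norm_bound(1) k0) auto
    finally show "dist (\<Psi> G x) (\<Psi> H x) \<le> k * C * dist G H" by (simp add: mult.assoc)
  qed
  have "\<exists>!G. \<Psi> G = G"
    by (rule banach_fix_type[OF kC]) (use contr in blast)
  moreover have "\<Psi> G = G \<longleftrightarrow> (\<forall>x. let t = max 0 (min 1 x) in G x = F t (bvp_sol A B G t) (bvp_sol' A B G t))" for G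
    unfolding apply_bcontfun_inject[symmetric] \<Psi> fun_eq_iff \<Theta>_def cl_def Let_def by metis
  ultimately show ?thesis by simp
qed

end

theorem proposition3p14:
  fixes \<sigma> \<beta> S :: "real \<Rightarrow> real"
    and F :: "real \<Rightarrow> real \<Rightarrow> real \<Rightarrow> real"
    and k A B :: real
  assumes "continuous_on UNIV \<sigma>" and "continuous_on UNIV \<beta>" and "\<And>x. \<sigma> x > 0"
    and "\<And>\<Phi> n. mollifier \<Phi> \<Longrightarrow> n \<ge> 1 \<Longrightarrow> convolution_exists (\<lambda>x. (\<sigma> x)\<^sup>2) (rescale \<Phi> n)"
    and "\<And>\<Phi> n. mollifier \<Phi> \<Longrightarrow> n \<ge> 1 \<Longrightarrow> convolution_exists \<beta> (rescale \<Phi> n)"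
    and "is_Sigma \<sigma> \<beta> S"
    and "continuous_on ({0..1} \<times> UNIV \<times> UNIV) (\<lambda>(x, y, z). F x y z)"
    and "\<And>x y y' z z'. x \<in> {0..1} \<Longrightarrow>
           \<bar>F x y z - F x y' z'\<bar> \<le> k * (\<bar>y - y'\<bar> + \<bar>z - z'\<bar>)"
    and "k < inverse (SUP x\<in>{0..1}. LBINT y=0..1. \<bar>K \<sigma> S x y\<bar> + \<bar>dK \<sigma> S x y\<bar>)"
  shows "\<exists>!u. u \<in> extensional {0..1} \<and> bvp_solution \<sigma> \<beta> 0 1 A B F u"
proof -
  interpret generator \<sigma> \<beta> S using assms(1-6) by unfold_locales
  note iff = bvp_solution_iff[of A B F]
  define fixp :: "(real \<Rightarrow>\<^sub>C real) \<Rightarrow> bool" where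
    "fixp = (\<lambda>G. \<forall>x. let t = max 0 (min 1 x) in G x = F t (bvp_sol A B G t) (bvp_sol' A B G t))"
  have "\<exists>!G. fixp G"
    unfolding fixp_def by (rule rhs_fixpoint[OF assms(7,8)]) (use assms(9) in \<open>simp_all add: kernel_norm_def\<close>)
  then obtain G where G: "fixp G" and unique: "\<And>H. fixp H \<Longrightarrow> H = G" by blast
  have G_eq: "G x = F x (bvp_sol A B G x) (bvp_sol' A B G x)" if "x \<in> {0..1}" for x
    using G that unfolding fixp_def by (auto simp: Let_def dest: spec[of _ x])
  \<comment> \<open>A solution is determined on \<open>{0..1}\<close> only; \<open>restrict\<close>
    picks the representative that is \<open>undefined\<close> elsewhere, for which uniqueness is
    literal.\<close>
  show ?thesis
  proof (rule ex1I[of _ "restrict (bvp_sol A B G) {0..1}"], intro conjI)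
    show "bvp_solution \<sigma> \<beta> 0 1 A B F (restrict (bvp_sol A B G) {0..1})"
      unfolding iff using G_eq by (intro exI[of _ "apply_bcontfun G"]) auto
  next
    fix u assume u: "u \<in> extensional {0..1} \<and> bvp_solution \<sigma> \<beta> 0 1 A B F u"
    then obtain g where g: "continuous_on UNIV g" "\<And>x. x \<in> {0..1} \<Longrightarrow> u x = bvp_sol A B g x"
      "\<And>x. x \<in> {0..1} \<Longrightarrow> g x = F x (bvp_sol A B g x) (bvp_sol' A B g x)"
      unfolding iff by blast
    \<comment> \<open>\<open>g\<close> may be unbounded on the line. Extending its restriction to
      \<open>{0..1}\<close> by constants gives a point of the Banach space and leaves the solution
      unchanged on \<open>{0..1}\<close>.\<close>
    define h where "h = (\<lambda>x. g (max 0 (min 1 x)))"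
    have h_eq: "h x = g x" if "x \<in> {0..1}" for x using that by (simp add: h_def)
    have "continuous_on UNIV h"
      unfolding h_def by (intro continuous_on_compose2[OF g(1)] continuous_intros) auto
    moreover have "bounded (range h)"
      by (rule bounded_subset[OF bounded_continuous_image[OF g(1), of 0 1]]) (auto simp: h_def)
    ultimately have "h \<in> bcontfun" by (simp add: bcontfun_def)
    then obtain H where H: "h = apply_bcontfun H" by (rule bcontfunE)
    have "fixp H"
      unfolding fixp_def Let_def H[symmetric]
    proof
      fix x :: real
      let ?t = "max 0 (min 1 x)"
      have t: "?t \<in> {0..1}" by simp
      show "h x = F ?t (bvp_sol A B h ?t) (bvp_sol' A B h ?t)"
        using g(3)[OF t] bvp_sol_cong[where g = h and h = g and x = ?t, OF h_eq t] by (simp add: h_def)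
    qed
    then have "h = apply_bcontfun G" using unique H by simp
    then have "u x = bvp_sol A B G x" if "x \<in> {0..1}" for x
      using g(2)[OF that] bvp_sol_cong(1)[OF h_eq that] by simp
    then show "u = restrict (bvp_sol A B G) {0..1}"
      using u by (intro extensionalityI[of u "{0..1}"]) auto
  qed auto
qed

end
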